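(* Let $C\subseteq\mathbb Q^k$ be a closed rational cone, $\omega$ a face-weight on $C$ and $f\colon\mathbb Z^k\to\mathbb C$ a quasi-polynomial. Then $$Z_{C,\omega,f}(\mathbf x)=\sum_{\mathbf n\in C\cap\mathbb Z^k}\omega(\mathbf n)f(\mathbf n)\mathbf x^{\mathbf n}\in\mathbb C\llbracket \mathbf x^{\pm1}\rrbracket$$ is the expansion of a rational function. Moreover, there is an equality of rational functions $$Z_{C,\omega,f}(\mathbf x^{-1})=Z_{C,\omega^\vee,f^\vee}(\mathbf x).$$
   Context: A closed (rational) cone $C\subseteq\mathbb Q^k$ is an intersection of finitely many half-spaces $\langle y,a\rangle\ge0$, $a\in\mathbb Q^k\setminus\{0\}$. A face of $C$ is $C$ itself or the intersection of $C$ with a supporting hyperplane; $F^\circ$ is the relative interior of a face $F$ ($F$ minus its proper faces), so $C$ is the disjoint union of the $F^\circ$. A face-weight $\omega$ assigns a number $\omega(F)\in\mathbb C$ to every face $F$ of $C$. Its dual is $\omega^\vee(F)=\sum_{G\supseteq F}(-1)^{\dim G}\omega(G)$, the sum over faces $G$ of $C$ containing $F$. A face-weight is regarded as a function on $C$ by $\omega(\mathbf n)=\omega(F)$ for $\mathbf n\in F^\circ$. A function $f\colon\mathbb Z^k\to\mathbb C$ is a quasi-polynomial if for some integer $N\ge1$ and every $\mathbf a\in\mathbb Z^k$ the function $\mathbf n\mapsto f(N\mathbf n+\mathbf a)$ is polynomial in $\mathbf n$. Put $f^\vee(\mathbf n)=f(-\mathbf n)$. $\mathbf x=(x_1,\ldots,x_k)$,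 $\mathbf x^{\mathbf n}=x_1^{n_1}\cdots x_k^{n_k}$, $\mathbf x^{-1}=(x_1^{-1},\ldots,x_k^{-1})$; $\mathbb C\llbracket\mathbf x^{\pm1}\rrbracket$ is the space of all formal doubly infinite series. A series $Z(\mathbf x)$ is an expansion of the rational function $g(\mathbf x)/h(\mathbf x)$ ($g,h$ Laurent polynomials, $h\ne0$) if $h(\mathbf x)Z(\mathbf x)=g(\mathbf x)$; such a rational function is unique and is denoted by the same symbol. *)

theory Defs
  imports
    "HOL-Analysis.Analysis"
    "HOL-Library.Poly_Mapping"
    "HOL-Computational_Algebra.Fraction_Field"
begin

section \<open>Rational cones, faces and face-weights\<close>

definition pairing :: "rat ^ 'k::finite \<Rightarrow> rat ^ 'k \<Rightarrow> rat" where
  "pairing y a = (\<Sum>i\<in>UNIV. y $ i * a $ i)"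

text \<open>The empty intersection is allowed, so the whole space is a cone.\<close>

definition rational_cone :: "(rat ^ 'k::finite) set \<Rightarrow> bool" where
  "rational_cone C \<longleftrightarrow>
     (\<exists>A. finite A \<and> 0 \<notin> A \<and> C = {y. \<forall>a\<in>A. pairing y a \<ge> 0})"

text \<open>Since a cone is closed under nonnegative scaling, a hyperplane that meets it and has it
  on one side passes through the origin; hence only linear hyperplanes occur below.\<close>

definition supporting_hyperplane :: "(rat ^ 'k::finite) set \<Rightarrow> (rat ^ 'k) set \<Rightarrow> bool" where
  "supporting_hyperplane C H \<longleftrightarrow>
     (\<exists>a. a \<noteq> 0 \<and> H = {y. pairing y a = 0} \<and> (\<forall>y\<in>C. pairing y a \<ge> 0))"

definition cone_face :: "(rat ^ 'k::finite) set \<Rightarrow> (rat ^ 'k) set \<Rightarrow> bool" where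
  "cone_face C F \<longleftrightarrow> F = C \<or> (\<exists>H. supporting_hyperplane C H \<and> F = C \<inter> H)"

definition cone_interior :: "(rat ^ 'k::finite) set \<Rightarrow> (rat ^ 'k) set" where
  "cone_interior F = F - \<Union>{G. cone_face F G \<and> G \<noteq> F}"

text \<open>A face-weight is a function on sets of which only the values at the faces of \<open>C\<close> are
  ever used. The dimension \<open>vec.dim F\<close> is that of the rational linear span of \<open>F\<close>.\<close>

definition dual_weight ::
    "(rat ^ 'k::finite) set \<Rightarrow> ((rat ^ 'k) set \<Rightarrow> complex) \<Rightarrow> (rat ^ 'k) set \<Rightarrow> complex" where
  "dual_weight C \<omega> F = (\<Sum>G | cone_face C G \<and> F \<subseteq> G. (- 1) ^ vec.dim G * \<omega> G)"

definition weight_at ::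
    "(rat ^ 'k::finite) set \<Rightarrow> ((rat ^ 'k) set \<Rightarrow> complex) \<Rightarrow> rat ^ 'k \<Rightarrow> complex" where
  "weight_at C \<omega> y = \<omega> (THE F. cone_face C F \<and> y \<in> cone_interior F)"


section \<open>Quasi-polynomials\<close>

text \<open>Polynomials are given by finitely supported families of coefficients, indexed by the
  exponent vectors.\<close>

definition polynomial_on_lattice :: "(int ^ 'k::finite \<Rightarrow> complex) \<Rightarrow> bool" where
  "polynomial_on_lattice f \<longleftrightarrow>
     (\<exists>p :: (nat ^ 'k) \<Rightarrow>\<^sub>0 complex. \<forall>n.
        f n = (\<Sum>e\<in>Poly_Mapping.keys p.
          Poly_Mapping.lookup p e * (\<Prod>i\<in>UNIV. of_int (n $ i) ^ (e $ i))))"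

definition quasi_polynomial :: "(int ^ 'k::finite \<Rightarrow> complex) \<Rightarrow> bool" where
  "quasi_polynomial f \<longleftrightarrow>
     (\<exists>N::int. N \<ge> 1 \<and> (\<forall>a. polynomial_on_lattice (\<lambda>n. f (N *s n + a))))"


section \<open>Laurent polynomials\<close>

text \<open>The ring of Laurent polynomials is the monoid algebra of \<open>int ^ 'k\<close>. It is a separate type
  because the library makes \<open>poly_mapping\<close> an integral domain only for linearly ordered
  exponents, whereas \<open>int ^ 'k\<close> is ordered componentwise.\<close>

typedef (overloaded) ('k::finite) laurent = "UNIV :: ((int ^ 'k) \<Rightarrow>\<^sub>0 complex) set" by simp

setup_lifting type_definition_laurent

instantiation laurent :: (finite) comm_ring_1
begin
lift_definition zero_laurent :: "'a laurent" is 0 .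
lift_definition one_laurent :: "'a laurent" is 1 .
lift_definition plus_laurent :: "'a laurent \<Rightarrow> 'a laurent \<Rightarrow> 'a laurent" is "(+)" .
lift_definition minus_laurent :: "'a laurent \<Rightarrow> 'a laurent \<Rightarrow> 'a laurent" is "(-)" .
lift_definition uminus_laurent :: "'a laurent \<Rightarrow> 'a laurent" is uminus .
lift_definition times_laurent :: "'a laurent \<Rightarrow> 'a laurent \<Rightarrow> 'a laurent" is "(*)" .
instance by standard (transfer; simp add: algebra_simps)+
end

lift_definition laurent_coeff :: "'k::finite laurent \<Rightarrow> int ^ 'k \<Rightarrow> complex" is Poly_Mapping.lookup .

lift_definition laurent_supp :: "'k::finite laurent \<Rightarrow> (int ^ 'k) set" is Poly_Mapping.keys .

lemma laurent_eqI: "(\<And>n. laurent_coeff p n = laurent_coeff q n) \<Longrightarrow> p = q"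
  by transfer (rule poly_mapping_eqI)

lemma finite_laurent_supp [simp]: "finite (laurent_supp p)"
  by transfer simp

lemma in_laurent_supp: "n \<in> laurent_supp p \<longleftrightarrow> laurent_coeff p n \<noteq> 0"
  by transfer (simp add: in_keys_iff)

lemma laurent_coeff_0 [simp]: "laurent_coeff 0 n = 0"
  by transfer simp

lemma laurent_supp_eq_empty [simp]: "laurent_supp p = {} \<longleftrightarrow> p = 0"
  by transfer simp

lemma lookup_times_group:
  fixes p q :: "'a::ab_group_add \<Rightarrow>\<^sub>0 'b::semiring_0"
  shows "Poly_Mapping.lookup (p * q) n =
    (\<Sum>l\<in>Poly_Mapping.keys p. Poly_Mapping.lookup p l * Poly_Mapping.lookup q (n - l))"
proof -
  have *: "(\<Sum>r. Poly_Mapping.lookup q r when n = l + r) = Poly_Mapping.lookup q (n - l)" for l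
  proof -
    have "(\<lambda>r. Poly_Mapping.lookup q r when n = l + r) =
        (\<lambda>r. Poly_Mapping.lookup q r when r = n - l)"
      by (auto simp: fun_eq_iff when_def algebra_simps)
    then show ?thesis by (simp only: Sum_any_when_equal)
  qed
  have "Poly_Mapping.lookup (p * q) n =
      (\<Sum>l. Poly_Mapping.lookup p l * Poly_Mapping.lookup q (n - l))"
    by (simp add: lookup_mult *)
  also have "\<dots> =
      (\<Sum>l\<in>Poly_Mapping.keys p. Poly_Mapping.lookup p l * Poly_Mapping.lookup q (n - l))"
    by (rule Sum_any.expand_superset) (auto simp: in_keys_iff)
  finally show ?thesis .
qed

lemma laurent_coeff_times:
  "laurent_coeff (p * q) n =
     (\<Sum>l\<in>laurent_supp p. laurent_coeff p l * laurent_coeff q (n - l))"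
  by transfer (rule lookup_times_group)

definition lex_less :: "int ^ 'k::finite \<Rightarrow> int ^ 'k \<Rightarrow> bool" where
  "lex_less x y \<longleftrightarrow> (\<exists>i. x $ i < y $ i \<and> (\<forall>j. to_nat j < to_nat i \<longrightarrow> x $ j = y $ j))"

lemma lex_less_irrefl: "\<not> lex_less x x"
  by (auto simp: lex_less_def)

lemma lex_less_trans:
  assumes "lex_less x y" "lex_less y z"
  shows "lex_less x z"
proof -
  obtain i where i: "x $ i < y $ i" "\<And>j. to_nat j < to_nat i \<Longrightarrow> x $ j = y $ j"
    using assms(1) by (auto simp: lex_less_def)
  obtain i' where i': "y $ i' < z $ i'" "\<And>j. to_nat j < to_nat i' \<Longrightarrow> y $ j = z $ j"
    using assms(2) by (auto simp: lex_less_def)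
  consider "to_nat i < to_nat i'" | "to_nat i' < to_nat i" | "i = i'"
    by (metis linorder_neqE_nat to_nat_split)
  then show ?thesis
  proof cases
    case 1
    then show ?thesis using i i' unfolding lex_less_def by (intro exI[of _ i]) auto
  next
    case 2
    then show ?thesis using i i' unfolding lex_less_def by (intro exI[of _ i']) auto
  next
    case 3
    then show ?thesis using i i' unfolding lex_less_def by (intro exI[of _ i]) auto
  qed
qed

lemma lex_less_total:
  assumes "x \<noteq> y"
  shows "lex_less x y \<or> lex_less y x"
proof -
  have "\<exists>i. x $ i \<noteq> y $ i" using assms by (simp add: vec_eq_iff)
  then obtain i where i: "x $ i \<noteq> y $ i" "\<And>j. x $ j \<noteq> y $ j \<Longrightarrow> to_nat i \<le> to_nat j"
    using ex_has_least_nat[of "\<lambda>i. x $ i \<noteq> y $ i" _ to_nat] by blast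
  then have "\<forall>j. to_nat j < to_nat i \<longrightarrow> x $ j = y $ j" by (meson not_le)
  with i(1) show ?thesis unfolding lex_less_def by (metis linorder_neqE)
qed

lemma lex_less_add: "lex_less x y \<Longrightarrow> lex_less (x + z) (y + z)"
  by (auto simp: lex_less_def)

lemma lex_max_exists:
  assumes "finite A" "A \<noteq> {}"
  obtains m where "m \<in> A" "\<And>x. x \<in> A \<Longrightarrow> x \<noteq> m \<Longrightarrow> lex_less x m"
proof -
  have "\<exists>m\<in>A. \<forall>x\<in>A. x \<noteq> m \<longrightarrow> lex_less x m"
    using assms
  proof (induction A rule: finite_ne_induct)
    case (insert a A)
    then obtain m where m: "m \<in> A" "\<forall>x\<in>A. x \<noteq> m \<longrightarrow> lex_less x m" by blast
    show ?case
    proof (cases "lex_less a m")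
      case True
      then show ?thesis using m by blast
    next
      case False
      moreover have "a \<noteq> m" using m(1) insert.hyps by auto
      ultimately have less: "lex_less m a" using lex_less_total by blast
      have "lex_less x a" if "x \<in> A" for x
        using m(2) that less lex_less_trans[of x m a] by (cases "x = m") auto
      then show ?thesis by auto
    qed
  qed auto
  then show ?thesis using that by blast
qed

instance laurent :: (finite) idom
proof
  fix p q :: "'a laurent"
  assume "p \<noteq> 0" "q \<noteq> 0"
  obtain m where m: "m \<in> laurent_supp p" "\<And>x. x \<in> laurent_supp p \<Longrightarrow> x \<noteq> m \<Longrightarrow> lex_less x m"
    using lex_max_exists[of "laurent_supp p"] \<open>p \<noteq> 0\<close> by auto
  obtain m' where m': "m' \<in> laurent_supp q"
      "\<And>x. x \<in> laurent_supp q \<Longrightarrow> x \<noteq> m' \<Longrightarrow> lex_less x m'"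
    using lex_max_exists[of "laurent_supp q"] \<open>q \<noteq> 0\<close> by auto
  have zero: "laurent_coeff p l * laurent_coeff q (m + m' - l) = 0"
    if "l \<in> laurent_supp p - {m}" for l
  proof (rule ccontr)
    assume "\<not> ?thesis"
    then have q: "m + m' - l \<in> laurent_supp q" by (simp add: in_laurent_supp)
    have "lex_less l m" using that m by auto
    then have lt: "lex_less m' (m + m' - l)"
      using lex_less_add[of l m "m' - l"] by (simp add: algebra_simps)
    moreover have "m + m' - l \<noteq> m'" using that by auto
    ultimately show False
      using m'(2)[OF q] lex_less_trans lex_less_irrefl by blast
  qed
  have "laurent_coeff (p * q) (m + m') = laurent_coeff p m * laurent_coeff q m'"
    unfolding laurent_coeff_times
    by (subst sum.remove[OF _ m(1)]) (simp_all add: zero)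
  then have "laurent_coeff (p * q) (m + m') \<noteq> 0"
    using m(1) m'(1) by (simp add: in_laurent_supp)
  then show "p * q \<noteq> 0" by auto
qed


section \<open>Rational functions and their expansions\<close>

type_synonym 'k ratfun = "'k laurent fract"

text \<open>The substitution of \<open>x\<^sub>i\<close> by its inverse for all \<open>i\<close>: on Laurent polynomials it sends the
  coefficient at \<open>n\<close> to \<open>- n\<close>, and it extends to fractions by acting on numerator and
  denominator.\<close>

lift_definition laurent_inv :: "'k::finite laurent \<Rightarrow> 'k laurent" is "Poly_Mapping.map_key uminus" .

lemma laurent_coeff_inv [simp]: "laurent_coeff (laurent_inv p) n = laurent_coeff p (- n)"
  by transfer (simp add: Poly_Mapping.map_key.rep_eq inj_def)

lemma laurent_supp_inv: "laurent_supp (laurent_inv p) = uminus ` laurent_supp p"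
proof -
  have "n \<in> uminus ` laurent_supp p" if "- n \<in> laurent_supp p" for n
    using imageI[OF that, of uminus] by simp
  then show ?thesis by (auto simp: in_laurent_supp)
qed

lemma laurent_inv_times: "laurent_inv (p * q) = laurent_inv p * laurent_inv q"
proof (rule laurent_eqI)
  fix n
  have "laurent_coeff (laurent_inv p * laurent_inv q) n
      = (\<Sum>l\<in>laurent_supp p. laurent_coeff p l * laurent_coeff q (- n - l))"
    unfolding laurent_coeff_times laurent_supp_inv
    by (simp add: sum.reindex o_def minus_diff_commute[of n])
  then show "laurent_coeff (laurent_inv (p * q)) n
      = laurent_coeff (laurent_inv p * laurent_inv q) n"
    by (simp add: laurent_coeff_times)
qed

lemma laurent_inv_eq_0 [simp]: "laurent_inv p = 0 \<longleftrightarrow> p = 0"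
  by (metis laurent_supp_eq_empty laurent_supp_inv image_is_empty)

lift_definition ratfun_inv :: "'k::finite ratfun \<Rightarrow> 'k ratfun"
  is "\<lambda>(g, h). (laurent_inv g, laurent_inv h)"
  by (auto simp flip: laurent_inv_times)

lemma ratfun_inv_Fract:
  "h \<noteq> 0 \<Longrightarrow> ratfun_inv (Fract g h) = Fract (laurent_inv g) (laurent_inv h)"
  by transfer simp

text \<open>Formal doubly infinite series are arbitrary functions \<open>int ^ 'k \<Rightarrow> complex\<close>; they form a
  module over the Laurent polynomials.\<close>

type_synonym 'k series = "int ^ 'k \<Rightarrow> complex"

definition laurent_act :: "'k::finite laurent \<Rightarrow> 'k series \<Rightarrow> 'k series" where
  "laurent_act h Z n = (\<Sum>m\<in>laurent_supp h. laurent_coeff h m * Z (n - m))"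

definition expansion_of :: "'k::finite series \<Rightarrow> 'k ratfun \<Rightarrow> bool" where
  "expansion_of Z R \<longleftrightarrow>
     (\<exists>g h. h \<noteq> 0 \<and> R = Fract g h \<and> laurent_act h Z = laurent_coeff g)"

definition ratfun_of :: "'k::finite series \<Rightarrow> 'k ratfun" where
  "ratfun_of Z = (THE R. expansion_of Z R)"

lemma laurent_act_coeff: "laurent_act p (laurent_coeff q) = laurent_coeff (p * q)"
  by (simp add: fun_eq_iff laurent_act_def laurent_coeff_times)

lemma laurent_act_commute:
  "laurent_act p (laurent_act q Z) = laurent_act q (laurent_act p Z)"
proof
  fix n
  have "laurent_act p (laurent_act q Z) n =
     (\<Sum>m\<in>laurent_supp p. \<Sum>l\<in>laurent_supp q.
        laurent_coeff p m * (laurent_coeff q l * Z (n - m - l)))"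
    by (simp add: laurent_act_def sum_distrib_left)
  also have "\<dots> = (\<Sum>l\<in>laurent_supp q. \<Sum>m\<in>laurent_supp p.
        laurent_coeff p m * (laurent_coeff q l * Z (n - m - l)))"
    by (rule sum.swap)
  also have "\<dots> = laurent_act q (laurent_act p Z) n"
    unfolding laurent_act_def sum_distrib_left
    by (intro sum.cong refl) (simp add: cancel_ab_semigroup_add_class.diff_right_commute[of n] mult.left_commute)
  finally show "laurent_act p (laurent_act q Z) n = laurent_act q (laurent_act p Z) n" .
qed

lemma expansion_of_unique:
  assumes "expansion_of Z R" "expansion_of Z R'"
  shows "R = R'"
proof -
  obtain g h where gh: "h \<noteq> 0" "R = Fract g h" "laurent_act h Z = laurent_coeff g"
    using assms(1) by (auto simp: expansion_of_def)
  obtain g' h' where gh': "h' \<noteq> 0" "R' = Fract g' h'" "laurent_act h' Z = laurent_coeff g'"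
    using assms(2) by (auto simp: expansion_of_def)
  have "laurent_coeff (h' * g) = laurent_coeff (h * g')"
    using laurent_act_commute[of h' h Z] by (simp add: gh(3) gh'(3) laurent_act_coeff)
  then have "h' * g = h * g'" by (metis laurent_eqI)
  then show ?thesis using gh gh' by (simp add: eq_fract mult.commute)
qed

lemma ratfun_of_eq: "expansion_of Z R \<Longrightarrow> ratfun_of Z = R"
  unfolding ratfun_of_def using expansion_of_unique by blast


section \<open>The generating series of a weighted cone\<close>

definition rat_point :: "int ^ 'k::finite \<Rightarrow> rat ^ 'k" where
  "rat_point n = (\<chi> i. of_int (n $ i))"

definition cone_series ::
    "(rat ^ 'k::finite) set \<Rightarrow> ((rat ^ 'k) set \<Rightarrow> complex) \<Rightarrow> (int ^ 'k \<Rightarrow> complex)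
      \<Rightarrow> 'k series" where
  "cone_series C \<omega> f n =
     (if rat_point n \<in> C then weight_at C \<omega> (rat_point n) * f n else 0)"

end

theory Submission
  imports Defs
begin

text \<open>By linearity and \<open>\<omega>\<^sup>\<or>(F) = \<Sum>G \<supseteq> F. (-1)\<^bsup>dim G\<^esup> \<omega>(G)\<close> it suffices to compare, for each face \<open>G\<close> of
  dimension \<open>d\<close>, the series of \<open>f\<close> over \<open>G\<^sup>\<circ>\<close> and over \<open>-G\<close>: they should agree up to the sign
  \<open>(-1)\<^sup>d\<close> modulo series annihilated by a nonzero Laurent polynomial (``torsion''). In the linear span
  \<open>V\<close> of \<open>G\<close> these two sets are \<open>{a < 0 for all a \<in> A}\<close> and \<open>{a \<ge> 0 for all a \<in> A}\<close> for some finite set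
  \<open>A\<close> of functionals that are simultaneously positive at some point of \<open>V\<close>. No triangulation is
  needed. If \<open>A\<close> is linearly dependent on \<open>V\<close>, then a relation
  \<open>a + \<Sum>P \<mu>\<^sub>p p = \<Sum>N \<nu>\<^sub>b b\<close> with \<open>\<mu> \<ge> 0\<close>, \<open>\<nu> > 0\<close> makes \<open>\<Prod>\<^bsub>A - N\<^esub> [p \<ge> 0] \<cdot> \<Prod>\<^bsub>N\<^esub> (1 - [b \<ge> 0])\<close>
  vanish; expanding it expresses the indicator of \<open>A\<close> by those of proper subsets, and the same
  identity holds for the conditions \<open>< 0\<close>. If \<open>A\<close> is independent, expand
  \<open>\<Prod> [a < 0] = \<Prod> (1 - [a \<ge> 0])\<close>: for every subset not spanning the dual of \<open>V\<close> the cone is invariant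
  under a lattice vector \<open>v\<close>, so a power of \<open>1 - x\<^sup>v\<close> annihilates its series, and only the term
  \<open>(-1)\<^sup>d \<Prod> [a \<ge> 0]\<close> can survive.\<close>

section \<open>Rational series modulo torsion\<close>

lemma ex_laurent_coeff:
  assumes "finite {n. Z n \<noteq> 0}"
  obtains g where "laurent_coeff g = Z"
proof -
  have "laurent_coeff (Abs_laurent (Abs_poly_mapping Z)) = Z"
    using assms by (simp add: laurent_coeff.abs_eq lookup_Abs_poly_mapping)
  then show ?thesis using that by blast
qed

text \<open>Each coefficient of a product involves only finitely many coefficients of the series, so
  the series may be replaced by a Laurent polynomial.\<close>

lemma laurent_act_mult: "laurent_act (p * q) Z = laurent_act p (laurent_act q Z)"
proof
  fix n
  define T where "T = (\<lambda>m. n - m) ` laurent_supp (p * q) \<union>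
    (\<lambda>(m, l). n - m - l) ` (laurent_supp p \<times> laurent_supp q)"
  have "finite T" by (simp add: T_def)
  then have "finite {n. (if n \<in> T then Z n else 0) \<noteq> 0}"
    by (auto intro: finite_subset[of _ T])
  then obtain g where g: "laurent_coeff g = (\<lambda>n. if n \<in> T then Z n else 0)"
    by (rule ex_laurent_coeff)
  have "laurent_act (p * q) Z n = laurent_act (p * q) (laurent_coeff g) n"
    unfolding laurent_act_def by (intro sum.cong) (auto simp: g T_def)
  also have "\<dots> = laurent_act p (laurent_act q (laurent_coeff g)) n"
    by (simp add: laurent_act_coeff mult.assoc)
  also have "\<dots> = laurent_act p (laurent_act q Z) n"
    unfolding laurent_act_def by (intro sum.cong arg_cong2[where f="(*)"] refl) (force simp: g T_def)
  finally show "laurent_act (p * q) Z n = laurent_act p (laurent_act q Z) n" .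
qed

lemma laurent_act_add:
  "laurent_act h (\<lambda>n. Y n + Z n) = (\<lambda>n. laurent_act h Y n + laurent_act h Z n)"
  by (simp add: laurent_act_def fun_eq_iff sum.distrib algebra_simps)

lemma laurent_act_scale:
  "laurent_act h (\<lambda>n. c * Z n) = (\<lambda>n. c * laurent_act h Z n)"
  by (simp add: laurent_act_def fun_eq_iff sum_distrib_left algebra_simps)

lemma laurent_act_zero [simp]: "laurent_act h (\<lambda>n. 0) = (\<lambda>n. 0)"
  by (simp add: laurent_act_def fun_eq_iff)

lemma laurent_act_one [simp]: "laurent_act 1 Z = Z" for Z :: "'k::finite series"
proof -
  have "laurent_supp (1 :: 'k laurent) = {0}" "laurent_coeff (1 :: 'k laurent) 0 = 1"
    by (transfer, simp)+
  then show ?thesis by (simp add: laurent_act_def fun_eq_iff)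
qed

lemma laurent_act_inv:
  "laurent_act (laurent_inv h) (\<lambda>n. Z (- n)) = (\<lambda>n. laurent_act h Z (- n))"
  by (simp add: laurent_act_def fun_eq_iff laurent_supp_inv sum.reindex minus_diff_commute)

definition rational_series :: "'k::finite series \<Rightarrow> bool" where
  "rational_series Z \<longleftrightarrow> (\<exists>h g. h \<noteq> 0 \<and> laurent_act h Z = laurent_coeff g)"

text \<open>These are exactly the expansions of the rational function 0, so equality modulo torsion
  is what equality of rational functions means for rational series.\<close>

definition torsion_series :: "'k::finite series \<Rightarrow> bool" where
  "torsion_series Z \<longleftrightarrow> (\<exists>h. h \<noteq> 0 \<and> laurent_act h Z = (\<lambda>n. 0))"

lemma rational_series_iff: "rational_series Z \<longleftrightarrow> (\<exists>R. expansion_of Z R)"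
  by (auto simp: rational_series_def expansion_of_def)

lemma laurent_coeff_0_fun: "laurent_coeff 0 = (\<lambda>n. 0)"
  by (simp add: fun_eq_iff)

lemma laurent_coeff_add: "laurent_coeff (p + q) = (\<lambda>n. laurent_coeff p n + laurent_coeff q n)"
  by transfer (simp add: fun_eq_iff lookup_add)

lemma torsion_imp_rational: "torsion_series Z \<Longrightarrow> rational_series Z"
  unfolding torsion_series_def rational_series_def laurent_coeff_0_fun[symmetric] by blast

lemma rational_series_zero: "rational_series (\<lambda>n. 0)"
  and torsion_series_zero: "torsion_series (\<lambda>n. 0)"
proof -
  show "torsion_series (\<lambda>n. 0)" unfolding torsion_series_def by (intro exI[of _ 1]) simp
  then show "rational_series (\<lambda>n. 0)" by (rule torsion_imp_rational)
qed

lemma torsion_series_add: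
  assumes "torsion_series Y" "torsion_series Z"
  shows "torsion_series (\<lambda>n. Y n + Z n)"
proof -
  obtain h k where hk: "h \<noteq> 0" "k \<noteq> 0" "laurent_act h Y = (\<lambda>n. 0)" "laurent_act k Z = (\<lambda>n. 0)"
    using assms by (auto simp: torsion_series_def)
  have "laurent_act (k * h) Y = (\<lambda>n. 0)" "laurent_act (h * k) Z = (\<lambda>n. 0)"
    by (simp_all add: laurent_act_mult hk)
  then have "laurent_act (h * k) (\<lambda>n. Y n + Z n) = (\<lambda>n. 0)"
    by (simp add: laurent_act_add mult.commute)
  then show ?thesis using hk unfolding torsion_series_def by (intro exI[of _ "h * k"]) simp
qed

lemma rational_series_add:
  assumes "rational_series Y" "rational_series Z"
  shows "rational_series (\<lambda>n. Y n + Z n)"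
proof -
  obtain h k y z where hk: "h \<noteq> 0" "k \<noteq> 0" "laurent_act h Y = laurent_coeff y"
      "laurent_act k Z = laurent_coeff z"
    using assms by (auto simp: rational_series_def)
  have "laurent_act (k * h) Y = laurent_coeff (k * y)" "laurent_act (h * k) Z = laurent_coeff (h * z)"
    by (simp_all add: laurent_act_mult hk laurent_act_coeff)
  then have "laurent_act (h * k) (\<lambda>n. Y n + Z n) = laurent_coeff (k * y + h * z)"
    unfolding laurent_act_add by (simp add: mult.commute[of h k] laurent_coeff_add)
  then show ?thesis using hk unfolding rational_series_def
    by (intro exI[of _ "h * k"] exI[of _ "k * y + h * z"]) simp
qed

lemma torsion_series_scale: "torsion_series Z \<Longrightarrow> torsion_series (\<lambda>n. c * Z n)"
  unfolding torsion_series_def by (auto simp: laurent_act_scale)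

lemma rational_series_scale:
  assumes "rational_series Z"
  shows "rational_series (\<lambda>n. c * Z n)"
proof -
  obtain h g where hg: "h \<noteq> 0" "laurent_act h Z = laurent_coeff g"
    using assms by (auto simp: rational_series_def)
  have "finite {n. c * laurent_coeff g n \<noteq> 0}"
    by (rule finite_subset[OF _ finite_laurent_supp[of g]]) (auto simp: in_laurent_supp)
  then obtain g' where "laurent_coeff g' = (\<lambda>n. c * laurent_coeff g n)"
    by (rule ex_laurent_coeff)
  then show ?thesis using hg unfolding rational_series_def
    by (intro exI[of _ h] exI[of _ g']) (simp add: laurent_act_scale)
qed

lemma torsion_series_sum:
  "(\<And>i. i \<in> I \<Longrightarrow> torsion_series (Z i)) \<Longrightarrow> torsion_series (\<lambda>n. \<Sum>i\<in>I. c i * Z i n)"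
  by (induction I rule: infinite_finite_induct)
     (auto simp: torsion_series_zero intro!: torsion_series_add torsion_series_scale)

lemma rational_series_sum:
  "(\<And>i. i \<in> I \<Longrightarrow> rational_series (Z i)) \<Longrightarrow> rational_series (\<lambda>n. \<Sum>i\<in>I. c i * Z i n)"
  by (induction I rule: infinite_finite_induct)
     (auto simp: rational_series_zero intro!: rational_series_add rational_series_scale)

lemma rational_series_inv: "rational_series Z \<Longrightarrow> rational_series (\<lambda>n. Z (- n))"
proof -
  assume "rational_series Z"
  then obtain h g where hg: "h \<noteq> 0" "laurent_act h Z = laurent_coeff g"
    by (auto simp: rational_series_def)
  then have "laurent_act (laurent_inv h) (\<lambda>n. Z (- n)) = laurent_coeff (laurent_inv g)"
    by (simp add: laurent_act_inv fun_eq_iff)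
  then show ?thesis unfolding rational_series_def
    using hg(1) by (intro exI[of _ "laurent_inv h"] exI[of _ "laurent_inv g"]) simp
qed

lemma torsion_series_inv: "torsion_series Z \<Longrightarrow> torsion_series (\<lambda>n. Z (- n))"
  unfolding torsion_series_def by (metis laurent_act_inv laurent_inv_eq_0)

text \<open>With \<open>Y = g/h\<close> and an annihilator \<open>k\<close> of the torsion
  difference, the single factor \<open>k * laurent_inv h\<close> kills the difference and sends the
  reflected \<open>Y\<close> to \<open>k * laurent_inv g\<close>. The common factor \<open>k\<close>
  then cancels in the fraction.\<close>

lemma ratfun_inv_ratfun_of:
  assumes "rational_series Y" "torsion_series (\<lambda>n. Z n - Y (- n))"
  shows "ratfun_inv (ratfun_of Y) = ratfun_of Z"
proof -
  obtain h g where hg: "h \<noteq> 0" "laurent_act h Y = laurent_coeff g"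
    using assms(1) by (auto simp: rational_series_def)
  obtain k where k: "k \<noteq> 0" "laurent_act k (\<lambda>n. Z n - Y (- n)) = (\<lambda>n. 0)"
    using assms(2) by (auto simp: torsion_series_def)
  have "expansion_of Y (Fract g h)" using hg by (auto simp: expansion_of_def)
  then have Y: "ratfun_inv (ratfun_of Y) = Fract (laurent_inv g) (laurent_inv h)"
    by (simp add: ratfun_of_eq ratfun_inv_Fract hg(1))
  have "laurent_act (k * laurent_inv h) (\<lambda>n. Z n - Y (- n)) = (\<lambda>n. 0)"
    by (subst mult.commute) (simp add: laurent_act_mult k)
  moreover have "(\<lambda>n. laurent_coeff g (- n)) = laurent_coeff (laurent_inv g)"
    by (simp add: fun_eq_iff)
  then have "laurent_act (k * laurent_inv h) (\<lambda>n. Y (- n)) = laurent_coeff (k * laurent_inv g)"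
    by (simp only: laurent_act_mult laurent_act_inv hg(2) laurent_act_coeff)
  ultimately have "laurent_act (k * laurent_inv h) (\<lambda>n. (Z n - Y (- n)) + Y (- n)) =
      laurent_coeff (k * laurent_inv g)"
    unfolding laurent_act_add by simp
  then have "expansion_of Z (Fract (k * laurent_inv g) (k * laurent_inv h))"
    unfolding expansion_of_def using hg(1) k(1)
    by (intro exI[of _ "k * laurent_inv g"] exI[of _ "k * laurent_inv h"]) simp
  then show ?thesis using Y hg k by (simp add: ratfun_of_eq eq_fract)
qed


section \<open>Iterated differences and quasi-polynomials\<close>

text \<open>The action of \<open>1 - x^v\<close>, written as a backward difference so that its
  nilpotency on polynomials becomes visible.\<close>

definition bdiff :: "int ^ 'k::finite \<Rightarrow> 'k series \<Rightarrow> 'k series" where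
  "bdiff v Z n = Z n - Z (n - v)"

text \<open>The multiplier is \<open>(1 - x^v)^M\<close>; the condition on \<open>v\<close> keeps
  the two monomials from cancelling.\<close>

lemma bdiff_pow_laurent_act:
  assumes "v \<noteq> 0"
  obtains h where "h \<noteq> 0" "\<And>Z. laurent_act h Z = (bdiff v ^^ M) Z"
proof -
  have "finite {n. (if n = 0 then 1 else if n = v then - 1 else (0::complex)) \<noteq> 0}"
    by (rule finite_subset[of _ "{0, v}"]) auto
  then obtain g where g: "laurent_coeff g = (\<lambda>n. if n = 0 then 1 else if n = v then - 1 else 0)"
    by (rule ex_laurent_coeff)
  then have "laurent_supp g = {0, v}" by (auto simp: in_laurent_supp split: if_splits)
  then have act: "laurent_act g Z = bdiff v Z" for Z
    using assms by (auto simp: laurent_act_def bdiff_def g fun_eq_iff)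
  have "laurent_act (g ^ M) Z = (bdiff v ^^ M) Z" for Z
    by (induction M arbitrary: Z) (simp_all add: laurent_act_mult act)
  moreover have "g \<noteq> 0" using g by (metis laurent_coeff_0 zero_neq_one)
  ultimately show ?thesis using that[of "g ^ M"] by simp
qed

lemma bdiff_pow_Suc: "(bdiff v ^^ Suc M) Z n = (bdiff v ^^ M) Z n - (bdiff v ^^ M) Z (n - v)"
  by (simp add: bdiff_def)

lemma bdiff_pow_zero [simp]: "(bdiff v ^^ M) (\<lambda>n. 0) = (\<lambda>n. 0)"
  by (induction M) (simp_all add: bdiff_def fun_eq_iff)

lemma bdiff_pow_add:
  "(bdiff v ^^ M) (\<lambda>n. Y n + Z n) = (\<lambda>n. (bdiff v ^^ M) Y n + (bdiff v ^^ M) Z n)"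
  by (induction M) (simp_all add: bdiff_def fun_eq_iff)

lemma bdiff_pow_scale: "(bdiff v ^^ M) (\<lambda>n. c * Z n) = (\<lambda>n. c * (bdiff v ^^ M) Z n)"
  by (induction M) (simp_all add: bdiff_def fun_eq_iff algebra_simps)

lemma bdiff_pow_shift: "(bdiff v ^^ M) (\<lambda>n. Z (n - u)) = (\<lambda>n. (bdiff v ^^ M) Z (n - u))"
  by (induction M) (simp_all add: bdiff_def fun_eq_iff algebra_simps)

lemma bdiff_pow_commute:
  "(bdiff v ^^ M) ((bdiff u ^^ K) Z) = (bdiff u ^^ K) ((bdiff v ^^ M) Z)"
proof -
  have "bdiff v (bdiff u Z) = bdiff u (bdiff v Z)" for Z
    by (simp add: bdiff_def fun_eq_iff algebra_simps)
  then have "bdiff v ((bdiff u ^^ K) Z) = (bdiff u ^^ K) (bdiff v Z)" for Z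
    by (induction K) simp_all
  then show ?thesis by (induction M) simp_all
qed

lemma bdiff_pow_mono:
  assumes "(bdiff v ^^ M) Z = (\<lambda>n. 0)" "M \<le> K"
  shows "(bdiff v ^^ K) Z = (\<lambda>n. 0)"
proof -
  have "(bdiff v ^^ (K - M + M)) Z = (\<lambda>n. 0)" unfolding funpow_add by (simp add: assms(1))
  then show ?thesis using assms(2) by simp
qed

text \<open>The \<open>M\<close>-fold difference at \<open>n\<close> samples only
  \<open>n, n - v, ..., n - M v\<close>. Wherever a truncation condition is constant along such a
  segment, a truncated series may therefore be traded for a scalar multiple of the untruncated
  one.\<close>

lemma bdiff_pow_cong:
  assumes "\<And>j. j \<le> M \<Longrightarrow> Y (n - int j *s v) = Z (n - int j *s v)"
  shows "(bdiff v ^^ M) Y n = (bdiff v ^^ M) Z n"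
  using assms
proof (induction M arbitrary: n)
  case 0
  show ?case using 0[of 0] by simp
next
  case (Suc M)
  have "n - v - int j *s v = n - int (Suc j) *s v" for j
    by (simp add: vec_eq_iff algebra_simps)
  then have "(bdiff v ^^ M) Y (n - v) = (bdiff v ^^ M) Z (n - v)"
    using Suc.prems by (intro Suc.IH) (metis Suc_le_mono)
  moreover have "(bdiff v ^^ M) Y n = (bdiff v ^^ M) Z n" using Suc by simp
  ultimately show ?case by (simp add: bdiff_pow_Suc del: funpow.simps)
qed

lemma bdiff_pow_support:
  assumes "\<And>n. Z n \<noteq> 0 \<Longrightarrow> n \<in> T" "\<And>n. n \<in> T \<Longrightarrow> n + v \<in> T" "(bdiff v ^^ M) Z n \<noteq> 0"
  shows "n \<in> T"
  using assms(3)
proof (induction M arbitrary: n)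
  case (Suc M)
  then have "(bdiff v ^^ M) Z n \<noteq> 0 \<or> (bdiff v ^^ M) Z (n - v) \<noteq> 0"
    unfolding bdiff_pow_Suc by auto
  then consider "(bdiff v ^^ M) Z n \<noteq> 0" | "(bdiff v ^^ M) Z (n - v) \<noteq> 0" by blast
  then show ?case using Suc.IH assms(2)[of "n - v"] by cases auto
qed (use assms(1) in simp)

text \<open>Discrete product rule: one difference of \<open>n_i Z\<close> leaves \<open>n_i\<close>
  times the difference of \<open>Z\<close>, which falls under the induction hypothesis, plus a
  multiple of a shift of \<open>Z\<close>, which is already killed.\<close>

lemma bdiff_pow_mult_coordinate:
  assumes "(bdiff v ^^ M) Z = (\<lambda>n. 0)"
  shows "(bdiff v ^^ Suc M) (\<lambda>n. of_int (n $ i) * Z n) = (\<lambda>n. 0)"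
  using assms
proof (induction M arbitrary: Z)
  case (Suc M)
  have eq: "bdiff v (\<lambda>n. of_int (n $ i) * Z n) =
      (\<lambda>n. of_int (n $ i) * bdiff v Z n + of_int (v $ i) * Z (n - v))"
    by (simp add: bdiff_def fun_eq_iff algebra_simps)
  have "(bdiff v ^^ M) (bdiff v Z) = (\<lambda>n. 0)" using Suc.prems by (simp only: funpow_Suc_right o_def)
  then have "(bdiff v ^^ Suc M) (\<lambda>n. of_int (n $ i) * bdiff v Z n) = (\<lambda>n. 0)" by (rule Suc.IH)
  moreover have "(bdiff v ^^ Suc M) (\<lambda>n. of_int (v $ i) * Z (n - v)) = (\<lambda>n. 0)"
    unfolding bdiff_pow_scale bdiff_pow_shift Suc.prems by simp
  ultimately have "(bdiff v ^^ Suc M) (bdiff v (\<lambda>n. of_int (n $ i) * Z n)) = (\<lambda>n. 0)"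
    unfolding eq bdiff_pow_add by simp
  then show ?case by (subst funpow_Suc_right) (simp only: o_def)
qed (simp add: bdiff_def fun_eq_iff)

text \<open>One difference kills constants, each further coordinate factor costs at most one more
  difference, and a sum is killed by the larger of the two exponents.\<close>

lemma polynomial_bdiff_nilpotent:
  assumes "polynomial_on_lattice f"
  shows "\<exists>M. (bdiff v ^^ M) f = (\<lambda>n. 0)"
proof -
  have add: "\<exists>M. (bdiff v ^^ M) (\<lambda>n. Y n + Z n) = (\<lambda>n. 0)"
    if YZ: "\<exists>M. (bdiff v ^^ M) Y = (\<lambda>n. 0)" "\<exists>M. (bdiff v ^^ M) Z = (\<lambda>n. 0)" for Y Z
  proof -
    obtain M K where "(bdiff v ^^ M) Y = (\<lambda>n. 0)" "(bdiff v ^^ K) Z = (\<lambda>n. 0)" using YZ by blast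
    then have "(bdiff v ^^ max M K) Y = (\<lambda>n. 0)" "(bdiff v ^^ max M K) Z = (\<lambda>n. 0)"
      by (auto elim: bdiff_pow_mono)
    then show ?thesis by (intro exI[of _ "max M K"]) (simp add: bdiff_pow_add)
  qed
  have scale: "\<exists>M. (bdiff v ^^ M) (\<lambda>n. c * Z n) = (\<lambda>n. 0)"
    if "\<exists>M. (bdiff v ^^ M) Z = (\<lambda>n. 0)" for c Z
    using that by (metis bdiff_pow_scale mult_zero_right)
  have const: "\<exists>M. (bdiff v ^^ M) (\<lambda>n. c) = (\<lambda>n. 0)" for c :: complex
    by (intro exI[of _ 1]) (simp add: bdiff_def fun_eq_iff)
  have power: "\<exists>M. (bdiff v ^^ M) (\<lambda>n. of_int (n $ i) ^ e * Z n) = (\<lambda>n. 0)"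
    if "\<exists>M. (bdiff v ^^ M) Z = (\<lambda>n. 0)" for i e Z
  proof (induction e)
    case (Suc e)
    then obtain M where "(bdiff v ^^ M) (\<lambda>n. of_int (n $ i) ^ e * Z n) = (\<lambda>n. 0)" by blast
    from bdiff_pow_mult_coordinate[OF this, of i] show ?case
      by (intro exI[of _ "Suc M"]) (simp add: mult.assoc del: funpow.simps)
  qed (use that in simp)
  have monomial: "\<exists>M. (bdiff v ^^ M) (\<lambda>n. \<Prod>i\<in>I. of_int (n $ i) ^ (e $ i)) = (\<lambda>n. 0)"
    if "finite I" for I and e :: "nat ^ 'a"
    using that by (induction I rule: finite_induct) (auto intro: const power)
  obtain p :: "(nat ^ 'a) \<Rightarrow>\<^sub>0 complex" where p: "f = (\<lambda>n. \<Sum>e\<in>Poly_Mapping.keys p.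
      Poly_Mapping.lookup p e * (\<Prod>i\<in>UNIV. of_int (n $ i) ^ (e $ i)))"
    using assms by (auto simp: polynomial_on_lattice_def fun_eq_iff)
  have "\<exists>M. (bdiff v ^^ M) (\<lambda>n. \<Sum>e\<in>E. Poly_Mapping.lookup p e *
      (\<Prod>i\<in>UNIV. of_int (n $ i) ^ (e $ i))) = (\<lambda>n. 0)" if "finite E" for E
    using that
  proof (induction E rule: finite_induct)
    case (insert e E)
    show ?case using add[OF scale[OF monomial[OF finite]] insert.IH] insert.hyps by simp
  qed (use const in simp)
  then show ?thesis unfolding p by simp
qed

text \<open>Steps along \<open>N v\<close> stay inside a residue class modulo \<open>N\<close>,
  where \<open>f\<close> is given by one polynomial in the quotient and the steps become steps along
  \<open>v\<close>.\<close>

lemma bdiff_pow_dilate: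
  "(bdiff (N *s v) ^^ M) f (N *s n + a) = (bdiff v ^^ M) (\<lambda>n. f (N *s n + a)) n"
proof (induction M arbitrary: n)
  case (Suc M)
  have "N *s n + a - N *s v = N *s (n - v) + a" by (simp add: vec_eq_iff algebra_simps)
  then show ?case by (simp only: bdiff_pow_Suc Suc)
qed simp

lemma finite_vec_box:
  fixes B :: "'k::finite \<Rightarrow> int set"
  assumes "\<And>i. finite (B i)"
  shows "finite {n. \<forall>i. n $ i \<in> B i}"
proof -
  have "{n. \<forall>i. n $ i \<in> B i} \<subseteq> (\<lambda>g. \<chi> i. g i) ` (PiE UNIV B)"
    by (auto simp: PiE_def intro!: image_eqI[of _ _ "vec_nth _"])
  then show ?thesis by (rule finite_subset) (intro finite_imageI finite_PiE finite assms)
qed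

text \<open>For every lattice vector divisible by \<open>N\<close>, a power of the corresponding
  \<open>1 - x^(N v)\<close> annihilates \<open>f\<close>. The exponent may depend on the direction,
  but not on the point.\<close>

definition locally_nilpotent :: "int \<Rightarrow> (int ^ 'k::finite \<Rightarrow> complex) \<Rightarrow> bool" where
  "locally_nilpotent N f \<longleftrightarrow> (\<forall>v. \<exists>M. (bdiff (N *s v) ^^ M) f = (\<lambda>n. 0))"

lemma quasi_polynomial_locally_nilpotent:
  assumes "quasi_polynomial f"
  obtains N where "N \<ge> 1" "locally_nilpotent N f"
proof -
  obtain N where N: "N \<ge> 1" "\<And>a. polynomial_on_lattice (\<lambda>n. f (N *s n + a))"
    using assms by (auto simp: quasi_polynomial_def)
  have "\<exists>M. (bdiff (N *s v) ^^ M) f = (\<lambda>n. 0)" for v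
  proof -
    obtain M where M: "(bdiff v ^^ M a) (\<lambda>n. f (N *s n + a)) = (\<lambda>n. 0)" for a
      using polynomial_bdiff_nilpotent[OF N(2)] by metis
    \<comment> \<open>Representatives of the residue classes modulo \<open>N\<close>. There are
      finitely many, so the exponents \<open>M a\<close> have a common bound
      \<open>K\<close>.\<close>
    define A :: "(int ^ 'a) set" where "A = {a. \<forall>i. a $ i \<in> {0..<N}}"
    have "finite A" unfolding A_def by (rule finite_vec_box) simp
    define K where "K = Max (insert 0 (M ` A))"
    have "(bdiff (N *s v) ^^ K) f m = 0" for m
    proof -
      define n a :: "int ^ 'a" where "n = (\<chi> i. m $ i div N)" and "a = (\<chi> i. m $ i mod N)"
      have m: "m = N *s n + a" by (simp add: n_def a_def vec_eq_iff)
      have "a \<in> A" using N(1) by (simp add: A_def a_def)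
      then have "M a \<le> K" unfolding K_def using \<open>finite A\<close> by (intro Max_ge) auto
      from bdiff_pow_mono[OF M this] show ?thesis unfolding m bdiff_pow_dilate by (rule fun_cong)
    qed
    then show ?thesis by blast
  qed
  then show ?thesis using N(1) that by (auto simp: locally_nilpotent_def)
qed

section \<open>Truncations of locally nilpotent functions\<close>

text \<open>\<open>P\<close> is constant on the segment sampled by the differences, so there the
  truncation is either \<open>f\<close> or zero, and the differences that kill \<open>f\<close> kill
  it too.\<close>

lemma torsion_series_translation_invariant:
  assumes "(bdiff v ^^ M) f = (\<lambda>n. 0)" "v \<noteq> 0" "\<And>n j. P (n - int j *s v) \<longleftrightarrow> P n"
  shows "torsion_series (\<lambda>n. if P n then f n else 0)"
proof -
  obtain h where h: "h \<noteq> 0" "\<And>Z. laurent_act h Z = (bdiff v ^^ M) Z"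
    using bdiff_pow_laurent_act[OF assms(2)] by blast
  have "(bdiff v ^^ M) (\<lambda>n. if P n then f n else 0) n = 0" for n
  proof -
    have "(bdiff v ^^ M) (\<lambda>n. if P n then f n else 0) n =
        (bdiff v ^^ M) (\<lambda>m. (if P n then 1 else 0) * f m) n"
      by (rule bdiff_pow_cong) (simp add: assms(3))
    then show ?thesis by (simp only: bdiff_pow_scale assms(1)) simp
  qed
  then show ?thesis using h unfolding torsion_series_def by (intro exI[of _ h]) auto
qed

text \<open>The factor \<open>(1 - x\<^bsup>v b\<^esup>)\<^bsup>M b\<^esup>\<close> confines the support to \<open>S b\<close>, and the factors for the other
  directions do not destroy this.\<close>

lemma confine_support:
  assumes "finite B"
    and "\<And>n. Z n \<noteq> 0 \<Longrightarrow> n \<in> T"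
    and "\<And>b n. b \<in> B \<Longrightarrow> n \<in> T \<Longrightarrow> n + v b \<in> T"
    and "\<And>b. b \<in> B \<Longrightarrow> v b \<noteq> 0"
    and "\<And>b n. b \<in> B \<Longrightarrow> (bdiff (v b) ^^ M b) Z n \<noteq> 0 \<Longrightarrow> n \<in> S b"
    and "\<And>b c n. b \<in> B \<Longrightarrow> c \<in> B \<Longrightarrow> b \<noteq> c \<Longrightarrow> n \<in> S c \<Longrightarrow> n + v b \<in> S c"
  shows "\<exists>h. h \<noteq> 0 \<and> (\<forall>n. laurent_act h Z n \<noteq> 0 \<longrightarrow> n \<in> T \<and> (\<forall>b\<in>B. n \<in> S b))"
  using assms
proof (induction B arbitrary: Z T rule: finite_induct)
  case empty
  show ?case using empty.prems(1) by (intro exI[of _ 1]) auto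
next
  case (insert b B)
  define Z' where "Z' = (bdiff (v b) ^^ M b) Z"
  obtain k where k: "k \<noteq> 0" "\<And>Z. laurent_act k Z = (bdiff (v b) ^^ M b) Z"
    using bdiff_pow_laurent_act[OF insert.prems(3)[OF insertI1]] by blast
  \<comment> \<open>Replacing \<open>T\<close> by \<open>T \<inter> S b\<close> records the
    confinement achieved so far; hence both \<open>Z\<close> and \<open>T\<close> vary in the
    induction. The new set is still stable under the remaining directions.\<close>
  have "\<exists>h. h \<noteq> 0 \<and> (\<forall>n. laurent_act h Z' n \<noteq> 0 \<longrightarrow> n \<in> T \<inter> S b \<and> (\<forall>c\<in>B. n \<in> S c))"
  proof (rule insert.IH)
    fix n assume n: "Z' n \<noteq> 0"
    have "n \<in> T"
      by (rule bdiff_pow_support[OF insert.prems(1) insert.prems(2)[OF insertI1] n[unfolded Z'_def]])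
    then show "n \<in> T \<inter> S b" using insert.prems(4) n by (auto simp: Z'_def)
  next
    fix c n assume c: "c \<in> B" and n: "n \<in> T \<inter> S b"
    then have "c \<noteq> b" using insert.hyps by auto
    then show "n + v c \<in> T \<inter> S b" using insert.prems(2)[of c n] insert.prems(5)[of c b n] c n by auto
  next
    fix c n assume c: "c \<in> B" and n: "(bdiff (v c) ^^ M c) Z' n \<noteq> 0"
    then have "c \<noteq> b" using insert.hyps by auto
    have Z: "(bdiff (v b) ^^ M b) ((bdiff (v c) ^^ M c) Z) n \<noteq> 0"
      using n by (simp add: Z'_def bdiff_pow_commute)
    have "\<And>n. n \<in> S c \<Longrightarrow> n + v b \<in> S c" "\<And>n. (bdiff (v c) ^^ M c) Z n \<noteq> 0 \<Longrightarrow> n \<in> S c"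
      using insert.prems(4,5) c \<open>c \<noteq> b\<close> by auto
    from bdiff_pow_support[OF this(2,1) Z] show "n \<in> S c" .
  qed (use insert.prems(3,5) in auto)
  then obtain h where h: "h \<noteq> 0"
      "\<And>n. laurent_act h Z' n \<noteq> 0 \<Longrightarrow> n \<in> T \<inter> S b \<and> (\<forall>c\<in>B. n \<in> S c)" by blast
  have "laurent_act (h * k) Z = laurent_act h Z'" by (simp add: laurent_act_mult k Z'_def)
  then show ?case using h k(1) by (intro exI[of _ "h * k"]) auto
qed

section \<open>Cones cut out in a subspace\<close>

lemma pairing_add_left: "pairing (x + y) a = pairing x a + pairing y a"
  by (simp add: pairing_def sum.distrib algebra_simps)

lemma pairing_diff_left: "pairing (x - y) a = pairing x a - pairing y a"
  by (simp add: pairing_def sum_subtractf algebra_simps)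

lemma pairing_scale_left: "pairing (c *s x) a = c * pairing x a"
  by (simp add: pairing_def sum_distrib_left algebra_simps)

lemma pairing_zero_left [simp]: "pairing 0 a = 0"
  by (simp add: pairing_def)

lemma pairing_sum_left: "pairing (\<Sum>i\<in>I. x i) a = (\<Sum>i\<in>I. pairing (x i) a)"
  by (induction I rule: infinite_finite_induct) (simp_all add: pairing_add_left)

lemma pairing_commute: "pairing x y = pairing y x"
  by (simp add: pairing_def mult.commute)

lemma pairing_minus_right [simp]: "pairing x (- a) = - pairing x a"
  by (simp add: pairing_def sum_negf)

lemma rat_point_add: "rat_point (m + n) = rat_point m + rat_point n"
  by (simp add: rat_point_def vec_eq_iff)

lemma rat_point_diff: "rat_point (m - n) = rat_point m - rat_point n"
  by (simp add: rat_point_def vec_eq_iff)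

lemma rat_point_scale: "rat_point (c *s n) = of_int c *s rat_point n"
  by (simp add: rat_point_def vec_eq_iff)

lemma rat_point_minus: "rat_point (- n) = - rat_point n"
  by (simp add: rat_point_def vec_eq_iff)

lemma rat_point_zero [simp]: "rat_point 0 = 0"
  by (simp add: rat_point_def vec_eq_iff)

lemma clear_denominators:
  fixes v :: "rat ^ 'k::finite"
  obtains c u where "c > 0" "rat_point u = of_int c *s v"
proof -
  define d where "d i = snd (quotient_of (v $ i))" for i
  have d: "d i > 0" for i by (simp add: d_def quotient_of_denom_pos')
  define c where "c = (\<Prod>i\<in>UNIV. d i)"
  have "\<exists>z. of_int z = of_int c * v $ i" for i
  proof -
    have "c = d i * (\<Prod>j\<in>UNIV - {i}. d j)" unfolding c_def by (rule prod.remove) auto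
    moreover have "of_int (d i) * v $ i = of_int (fst (quotient_of (v $ i)))"
    proof -
      obtain p q where pq: "quotient_of (v $ i) = (p, q)" by force
      then show ?thesis using quotient_of_div[OF pq] quotient_of_denom_pos[OF pq] by (simp add: d_def)
    qed
    ultimately have "of_int c * v $ i =
        of_int (fst (quotient_of (v $ i)) * (\<Prod>j\<in>UNIV - {i}. d j))"
      by (simp add: algebra_simps)
    then show ?thesis by metis
  qed
  then obtain z where "\<And>i. of_int (z i) = of_int c * v $ i" by metis
  then have "rat_point (\<chi> i. z i) = of_int c *s v" by (simp add: rat_point_def vec_eq_iff)
  moreover have "c > 0" unfolding c_def using d by (simp add: prod_pos)
  ultimately show ?thesis using that by blast
qed

text \<open>Induction on \<open>A\<close> with \<open>V\<close> varying: solve the problem on the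
  kernel of one functional \<open>b\<close> inside \<open>V\<close>, then adjust only the
  coefficient of \<open>b\<close>.\<close>

lemma functional_in_span:
  fixes V :: "(rat ^ 'k::finite) set"
  assumes "finite A" "vec.subspace V"
    and "\<And>y. y \<in> V \<Longrightarrow> (\<And>b. b \<in> A \<Longrightarrow> pairing y b = 0) \<Longrightarrow> pairing y c = 0"
  shows "\<exists>l. \<forall>y\<in>V. pairing y c = (\<Sum>b\<in>A. l b * pairing y b)"
  using assms
proof (induction A arbitrary: V rule: finite_induct)
  case (insert b A)
  define V' where "V' = {y\<in>V. pairing y b = 0}"
  have "vec.subspace V'" using insert.prems(1)
    by (auto simp: vec.subspace_def V'_def pairing_add_left pairing_scale_left)
  then have "\<exists>l. \<forall>y\<in>V'. pairing y c = (\<Sum>b\<in>A. l b * pairing y b)"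
    using insert.prems(2) by (intro insert.IH) (auto simp: V'_def)
  then obtain l where l: "\<And>y. y \<in> V' \<Longrightarrow> pairing y c = (\<Sum>b\<in>A. l b * pairing y b)" by blast
  have sum: "(\<Sum>x\<in>A. (l(b := t)) x * pairing y x) = (\<Sum>x\<in>A. l x * pairing y x)" for t y
    using insert.hyps by (intro sum.cong) auto
  show ?case
  proof (cases "\<exists>u\<in>V. pairing u b \<noteq> 0")
    case False
    then have "\<forall>y\<in>V. pairing y c = (\<Sum>x\<in>insert b A. (l(b := 0)) x * pairing y x)"
      using l insert.hyps unfolding V'_def by (simp add: sum del: fun_upd_apply)
    then show ?thesis by blast
  next
    case True
    then obtain u where u: "u \<in> V" "pairing u b \<noteq> 0" by blast
    \<comment> \<open>This coefficient makes the identity hold at \<open>u\<close>. Every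
      \<open>y\<close> in \<open>V\<close> is a multiple of \<open>u\<close> plus an element
      \<open>z\<close> of \<open>V'\<close>, where the identity holds already.\<close>
    define t where "t = (pairing u c - (\<Sum>x\<in>A. l x * pairing u x)) / pairing u b"
    have "pairing y c = t * pairing y b + (\<Sum>x\<in>A. l x * pairing y x)" if "y \<in> V" for y
    proof -
      define z where "z = y - (pairing y b / pairing u b) *s u"
      have "z \<in> V'" using u that insert.prems(1)
        by (auto simp: V'_def z_def pairing_diff_left pairing_scale_left
            intro!: vec.subspace_diff vec.subspace_scale)
      from l[OF this] have "pairing y c - (pairing y b / pairing u b) * pairing u c =
          (\<Sum>x\<in>A. l x * pairing y x) - (pairing y b / pairing u b) * (\<Sum>x\<in>A. l x * pairing u x)"
        by (simp add: z_def pairing_diff_left pairing_scale_left sum_subtractf sum_distrib_left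
            algebra_simps)
      then show ?thesis by (simp add: t_def divide_simps u) (simp add: algebra_simps)
    qed
    then have "\<forall>y\<in>V. pairing y c = (\<Sum>x\<in>insert b A. (l(b := t)) x * pairing y x)"
      using insert.hyps by (simp add: sum del: fun_upd_apply) simp
    then show ?thesis by blast
  qed
qed simp

section \<open>Inclusion-exclusion over sets of constraints\<close>

text \<open>The expansion of the product of the factors \<open>1 - [q b]\<close> over
  \<open>b\<close> in \<open>N\<close>.\<close>

lemma of_bool_none:
  assumes "finite N"
  shows "(of_bool (\<forall>b\<in>N. \<not> q b) :: complex) =
    (\<Sum>S\<in>Pow N. (- 1) ^ card S * of_bool (\<forall>b\<in>S. q b))"
  using assms
proof (induction N rule: finite_induct)
  case (insert a N)
  have fin: "finite S" if "S \<in> Pow N" for S using that insert.hyps finite_subset by blast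
  have inj: "inj_on (insert a) (Pow N)" and disj: "Pow N \<inter> insert a ` Pow N = {}"
    using insert.hyps by (auto simp: inj_on_def insert_eq_iff)
  have "(\<Sum>S\<in>Pow (insert a N). (- 1) ^ card S * of_bool (\<forall>b\<in>S. q b) :: complex) =
      (\<Sum>S\<in>Pow N. (- 1) ^ card S * of_bool (\<forall>b\<in>S. q b)) +
      (\<Sum>S\<in>Pow N. (- 1) ^ card (insert a S) * of_bool (\<forall>b\<in>insert a S. q b))"
    unfolding Pow_insert using insert.hyps disj
    by (subst sum.union_disjoint) (simp_all only: sum.reindex[OF inj] o_def finite_Pow_iff finite_imageI)
  also have "(\<Sum>S\<in>Pow N. (- 1) ^ card (insert a S) * of_bool (\<forall>b\<in>insert a S. q b)) =
      - of_bool (q a) * (\<Sum>S\<in>Pow N. (- 1) ^ card S * of_bool (\<forall>b\<in>S. q b) :: complex)"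
    unfolding sum_distrib_left
  proof (rule sum.cong)
    fix S assume "S \<in> Pow N"
    then have "card (insert a S) = Suc (card S)" using fin insert.hyps by (subst card_insert_disjoint) auto
    then show "(- 1) ^ card (insert a S) * of_bool (\<forall>b\<in>insert a S. q b) =
      - of_bool (q a) * ((- 1) ^ card S * of_bool (\<forall>b\<in>S. q b) :: complex)" by simp
  qed simp
  finally show ?case by (simp flip: insert.IH)
qed simp

text \<open>By the last assumption the product of \<open>[q a]\<close> over \<open>A - N\<close> and
  \<open>1 - [q b]\<close> over \<open>N\<close> vanishes. In its expansion the term
  \<open>S = N\<close> is, up to sign, the indicator of all of \<open>A\<close>; the remaining terms
  involve fewer constraints.\<close>

lemma of_bool_all_reduce:
  assumes "finite A" "N \<subseteq> A" "\<not> ((\<forall>a\<in>A - N. q a) \<and> (\<forall>b\<in>N. \<not> q b))"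
  shows "(of_bool (\<forall>a\<in>A. q a) :: complex) =
    (\<Sum>S\<in>Pow N - {N}. - ((- 1) ^ (card N + card S)) * of_bool (\<forall>a\<in>A - N \<union> S. q a))"
proof -
  have "finite N" using assms finite_subset by blast
  have A: "A \<union> N = A" using assms by blast
  have "0 = (of_bool (\<forall>a\<in>A - N. q a) :: complex) * of_bool (\<forall>b\<in>N. \<not> q b)"
    using assms(3) by auto
  also have "\<dots> = (\<Sum>S\<in>Pow N. (- 1) ^ card S * of_bool (\<forall>a\<in>A - N \<union> S. q a))"
    unfolding of_bool_none[OF \<open>finite N\<close>] sum_distrib_left by (intro sum.cong) auto
  also have "\<dots> = (- 1) ^ card N * of_bool (\<forall>a\<in>A. q a) +
      (\<Sum>S\<in>Pow N - {N}. (- 1) ^ card S * of_bool (\<forall>a\<in>A - N \<union> S. q a))"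
    using \<open>finite N\<close> by (subst sum.remove[of _ N]) (simp_all add: A)
  finally have "0 = (- 1) ^ card N * ((- 1) ^ card N * of_bool (\<forall>a\<in>A. q a) +
      (\<Sum>S\<in>Pow N - {N}. (- 1) ^ card S * of_bool (\<forall>a\<in>A - N \<union> S. q a) :: complex))" by simp
  also have "\<dots> = of_bool (\<forall>a\<in>A. q a) +
      (\<Sum>S\<in>Pow N - {N}. (- 1) ^ (card N + card S) * of_bool (\<forall>a\<in>A - N \<union> S. q a))"
    by (simp add: distrib_left sum_distrib_left power_add mult.assoc flip: power_mult_distrib)
  finally show ?thesis by (simp add: sum_negf eq_neg_iff_add_eq_0)
qed

text \<open>The sign condition \<open>q\<close> is a parameter so that one reduction identity serves
  the closed cone and the opposite open cone alike.\<close>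

definition constrained_series ::
    "(rat ^ 'k::finite) set \<Rightarrow> (int ^ 'k \<Rightarrow> complex) \<Rightarrow> (rat \<Rightarrow> bool) \<Rightarrow> (rat ^ 'k) set \<Rightarrow> 'k series"
  where "constrained_series V f q A n =
    (if rat_point n \<in> V \<and> (\<forall>a\<in>A. q (pairing (rat_point n) a)) then f n else 0)"

abbreviation "closed_series V f \<equiv> constrained_series V f (\<lambda>t. t \<ge> 0)"
abbreviation "open_series V f \<equiv> constrained_series V f (\<lambda>t. t < 0)"

text \<open>Clearing denominators and multiplying by \<open>N\<close> turns a rational direction
  into a lattice direction along which \<open>f\<close> is nilpotent. The factor is positive, so
  signs of pairings survive.\<close>

lemma bdiff_direction:
  assumes "vec.subspace V" "N \<ge> 1" "locally_nilpotent N f" "y \<in> V"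
  obtains u M c where "c > 0" "rat_point u = c *s y" "rat_point u \<in> V" "(bdiff u ^^ M) f = (\<lambda>n. 0)"
proof -
  obtain d u where du: "d > 0" "rat_point u = of_int d *s y" by (rule clear_denominators)
  obtain M where "(bdiff (N *s u) ^^ M) f = (\<lambda>n. 0)"
    using assms(3) by (auto simp: locally_nilpotent_def)
  moreover have "rat_point (N *s u) = of_int (N * d) *s y"
    by (simp add: rat_point_scale du)
  moreover have "of_int (N * d) > (0 :: rat)" using assms(2) du(1) by simp
  ultimately show ?thesis using that[of "of_int (N * d)" "N *s u" M] assms(1,4)
    by (simp add: vec.subspace_scale)
qed

lemma subspace_translate_iff:
  assumes "vec.subspace V" "v \<in> V"
  shows "x - c *s v \<in> V \<longleftrightarrow> x \<in> V"
  using vec.subspace_add[OF assms(1) _ vec.subspace_scale[OF assms, of c], of "x - c *s v"]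
    vec.subspace_diff[OF assms(1) _ vec.subspace_scale[OF assms, of c], of x] by auto

text \<open>Translation by a lattice multiple of \<open>y\<close> preserves \<open>V\<close> and
  changes none of the pairings with \<open>A\<close>, so the cone contains full lattice lines
  whenever it contains a lattice point.\<close>

lemma torsion_constrained_series:
  assumes "vec.subspace V" "N \<ge> 1" "locally_nilpotent N f"
    and "y \<in> V" "y \<noteq> 0" "\<And>a. a \<in> A \<Longrightarrow> pairing y a = 0"
  shows "torsion_series (constrained_series V f q A)"
proof -
  obtain u M c where u: "c > 0" "rat_point u = c *s y" "rat_point u \<in> V"
      "(bdiff u ^^ M) f = (\<lambda>n. 0)"
    by (rule bdiff_direction[OF assms(1-4)])
  have zero: "pairing (rat_point u) a = 0" if "a \<in> A" for a
    using assms(6)[OF that] by (simp add: u(2) pairing_scale_left)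
  have "u \<noteq> 0" using u(1,2) assms(5) by auto
  have "torsion_series (\<lambda>n. if rat_point n \<in> V \<and> (\<forall>a\<in>A. q (pairing (rat_point n) a)) then f n else 0)"
    by (rule torsion_series_translation_invariant[OF u(4) \<open>u \<noteq> 0\<close>])
      (simp add: rat_point_diff rat_point_scale subspace_translate_iff[OF assms(1) u(3)]
        pairing_diff_left pairing_scale_left zero)
  then show ?thesis by (simp add: constrained_series_def[abs_def])
qed

lemma constrained_series_none:
  assumes "finite A"
  shows "open_series V f A n = (\<Sum>T\<in>Pow A. (- 1) ^ card T * closed_series V f T n)"
proof (cases "rat_point n \<in> V")
  case True
  have "constrained_series V f q T n = f n * of_bool (\<forall>a\<in>T. q (pairing (rat_point n) a))" for q T
    using True by (simp add: constrained_series_def)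
  then show ?thesis using of_bool_none[OF assms, of "\<lambda>a. pairing (rat_point n) a \<ge> 0"]
    by (simp add: sum_distrib_left not_le mult_ac)
qed (simp add: constrained_series_def)

lemma constrained_series_reduce:
  assumes "finite A" "N \<subseteq> A"
    and "\<And>y. y \<in> V \<Longrightarrow> \<not> ((\<forall>a\<in>A - N. q (pairing y a)) \<and> (\<forall>b\<in>N. \<not> q (pairing y b)))"
  shows "constrained_series V f q A n =
    (\<Sum>S\<in>Pow N - {N}. - ((- 1) ^ (card N + card S)) * constrained_series V f q (A - N \<union> S) n)"
proof (cases "rat_point n \<in> V")
  case True
  have "constrained_series V f q T n = f n * of_bool (\<forall>a\<in>T. q (pairing (rat_point n) a))" for T
    using True by (simp add: constrained_series_def)
  then show ?thesis
    by (simp only: of_bool_all_reduce[OF assms(1,2) assms(3)[OF True]] sum_distrib_left mult_ac)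
qed (simp add: constrained_series_def)

text \<open>A linear relation among the functionals expresses the indicator of the cone through those of
  the cones with fewer constraints, and the complementary open cones satisfy the same identity.\<close>

lemma constrained_series_dependent:
  assumes "finite A" "a \<in> A" "w \<in> V" "\<And>b. b \<in> A \<Longrightarrow> pairing w b > 0"
    and l: "\<And>y. y \<in> V \<Longrightarrow> pairing y a = (\<Sum>b\<in>A - {a}. l b * pairing y b)"
  shows "\<exists>\<S> c. (\<forall>S\<in>\<S>. S \<subset> A) \<and>
    (\<forall>n. closed_series V f A n = (\<Sum>S\<in>\<S>. c S * closed_series V f S n)) \<and>
    (\<forall>n. open_series V f A n = (\<Sum>S\<in>\<S>. c S * open_series V f S n))"
proof -
  define N where "N = {b \<in> A - {a}. l b > 0}"
  have N: "N \<subseteq> A" "a \<notin> N" "finite N" using assms(1) by (auto simp: N_def)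
  define P where "P = A - {a} - N"
  have fin: "finite P" "finite N" using assms(1) by (auto simp: P_def N_def)
  \<comment> \<open>The nonpositive coefficients are moved to the left, so that all coefficients on
    both sides are nonnegative.\<close>
  have rel: "pairing y a + (\<Sum>b\<in>P. - l b * pairing y b) = (\<Sum>b\<in>N. l b * pairing y b)" if "y \<in> V" for y
  proof -
    have "(\<Sum>b\<in>A - {a}. l b * pairing y b) = (\<Sum>b\<in>P. l b * pairing y b) + (\<Sum>b\<in>N. l b * pairing y b)"
      using fin by (subst sum.union_disjoint[symmetric]) (auto simp: P_def N_def intro!: sum.cong)
    then show ?thesis using l[OF that] by (simp add: sum_negf)
  qed
  have P: "- l b \<ge> 0" if "b \<in> P" for b using that by (auto simp: P_def N_def)
  \<comment> \<open>With \<open>N\<close> empty, the left side at \<open>w\<close> would be positive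
    and the right side zero.\<close>
  have "N \<noteq> {}"
  proof
    assume "N = {}"
    then have "pairing w a + (\<Sum>b\<in>P. - l b * pairing w b) = 0" using rel[OF assms(3)] by simp
    moreover have "(\<Sum>b\<in>P. - l b * pairing w b) \<ge> 0"
      by (intro sum_nonneg mult_nonneg_nonneg P less_imp_le assms(4)) (auto simp: P_def)
    ultimately show False using assms(4)[OF assms(2)] by simp
  qed
  \<comment> \<open>Such a \<open>y\<close> makes the left side of \<open>rel\<close> nonnegative
    and the right side negative; strictness comes from \<open>N\<close> being nonempty.\<close>
  have closed: "\<not> ((\<forall>a\<in>A - N. pairing y a \<ge> 0) \<and> (\<forall>b\<in>N. \<not> pairing y b \<ge> 0))" if "y \<in> V" for y
  proof
    assume y: "(\<forall>a\<in>A - N. pairing y a \<ge> 0) \<and> (\<forall>b\<in>N. \<not> pairing y b \<ge> 0)"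
    have "(\<Sum>b\<in>P. - l b * pairing y b) \<ge> 0"
      by (intro sum_nonneg mult_nonneg_nonneg P) (use y in \<open>auto simp: P_def\<close>)
    moreover have "pairing y a \<ge> 0" using y assms(2) N by auto
    moreover have "(\<Sum>b\<in>N. l b * pairing y b) < (\<Sum>b\<in>N. 0)"
      using y fin \<open>N \<noteq> {}\<close> by (intro sum_strict_mono mult_pos_neg) (auto simp: N_def not_le)
    ultimately show False using rel[OF that] by simp
  qed
  \<comment> \<open>Now the left side is negative and the right side nonnegative; strictness comes
    from \<open>a\<close>, whose coefficient is 1 and which lies outside \<open>N\<close>.\<close>
  have open': "\<not> ((\<forall>a\<in>A - N. pairing y a < 0) \<and> (\<forall>b\<in>N. \<not> pairing y b < 0))" if "y \<in> V" for y
  proof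
    assume y: "(\<forall>a\<in>A - N. pairing y a < 0) \<and> (\<forall>b\<in>N. \<not> pairing y b < 0)"
    have "(\<Sum>b\<in>P. - l b * pairing y b) \<le> 0"
      by (intro sum_nonpos mult_nonneg_nonpos P) (use y in \<open>auto simp: P_def less_imp_le\<close>)
    moreover have "pairing y a < 0" using y assms(2) N by auto
    moreover have "(\<Sum>b\<in>N. l b * pairing y b) \<ge> 0"
      using y by (intro sum_nonneg mult_nonneg_nonneg) (auto simp: N_def not_less)
    ultimately show False using rel[OF that] by linarith
  qed
  have inj: "inj_on (\<lambda>S. A - N \<union> S) (Pow N - {N})"
  proof (rule inj_onI)
    fix S T assume "S \<in> Pow N - {N}" "T \<in> Pow N - {N}" "A - N \<union> S = A - N \<union> T"
    then have "(A - N \<union> S) \<inter> N = (A - N \<union> T) \<inter> N" "S \<subseteq> N" "T \<subseteq> N" by auto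
    then show "S = T" by blast
  qed
  define \<S> where "\<S> = (\<lambda>S. A - N \<union> S) ` (Pow N - {N})"
  \<comment> \<open>Intersecting with \<open>N\<close> recovers the subset from which
    \<open>S\<close> arose. The coefficient does not involve the sign condition, so it is the same
    for closed and open series.\<close>
  define c :: "_ \<Rightarrow> complex" where "c S = - ((- 1) ^ (card N + card (S \<inter> N)))" for S
  have eq: "(\<Sum>S\<in>\<S>. c S * constrained_series V f q S n) =
    (\<Sum>S\<in>Pow N - {N}. - ((- 1) ^ (card N + card S)) * constrained_series V f q (A - N \<union> S) n)" for q n
  proof -
    have "(A - N \<union> S) \<inter> N = S" if "S \<in> Pow N - {N}" for S using that by blast
    then show ?thesis unfolding \<S>_def sum.reindex[OF inj] o_def
      by (intro sum.cong) (simp_all add: c_def)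
  qed
  show ?thesis
  proof (intro exI[of _ \<S>] exI[of _ c] conjI ballI allI)
    fix S assume "S \<in> \<S>"
    then obtain T where "S = A - N \<union> T" "T \<subseteq> N" "T \<noteq> N" by (auto simp: \<S>_def)
    then show "S \<subset> A" using N by blast
  qed (simp_all only: eq constrained_series_reduce[OF assms(1) N(1) closed]
        constrained_series_reduce[OF assms(1) N(1) open'])
qed

section \<open>Simplicial cones\<close>

text \<open>The vectors \<open>v a\<close> pair diagonally with \<open>A\<close>, and
  \<open>A\<close> separates points of \<open>V\<close>. Hence they form a basis of
  \<open>V\<close>, with coordinates \<open>pairing y a / pairing (rat_point (v a)) a\<close>;
  bounded coordinates leave only finitely many lattice points.\<close>

lemma dual_vectors_dim_and_finite:
  fixes V :: "(rat ^ 'k::finite) set" and v :: "rat ^ 'k \<Rightarrow> int ^ 'k"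
  assumes "finite A" "vec.subspace V"
    and "\<And>y. y \<in> V \<Longrightarrow> (\<And>a. a \<in> A \<Longrightarrow> pairing y a = 0) \<Longrightarrow> y = 0"
    and "\<And>a. a \<in> A \<Longrightarrow> rat_point (v a) \<in> V"
    and "\<And>a. a \<in> A \<Longrightarrow> pairing (rat_point (v a)) a > 0"
    and "\<And>a b. a \<in> A \<Longrightarrow> b \<in> A \<Longrightarrow> a \<noteq> b \<Longrightarrow> pairing (rat_point (v a)) b = 0"
  shows "vec.dim V = card A"
    and "finite {n. rat_point n \<in> V \<and> (\<forall>a\<in>A. 0 \<le> pairing (rat_point n) a \<and>
      pairing (rat_point n) a \<le> of_nat (M a) * pairing (rat_point (v a)) a)}"
proof -
  have pair: "pairing (\<Sum>a\<in>A. c a *s rat_point (v a)) b = c b * pairing (rat_point (v b)) b"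
    if "b \<in> A" for b c
  proof -
    have "pairing (\<Sum>a\<in>A. c a *s rat_point (v a)) b =
        (\<Sum>a\<in>A. if a = b then c b * pairing (rat_point (v b)) b else 0)"
      unfolding pairing_sum_left pairing_scale_left by (intro sum.cong) (auto simp: assms(6) that)
    then show ?thesis using assms(1) that by simp
  qed
  have repr: "y = (\<Sum>a\<in>A. (pairing y a / pairing (rat_point (v a)) a) *s rat_point (v a))"
    (is "y = ?s") if "y \<in> V" for y
  proof -
    have "?s \<in> V" using assms(2,4) by (intro vec.subspace_sum vec.subspace_scale) auto
    then have "y - ?s \<in> V" using that assms(2) by (intro vec.subspace_diff)
    moreover have "pairing (y - ?s) b = 0" if "b \<in> A" for b
      unfolding pairing_diff_left pair[OF that] using assms(5)[OF that] by simp
    ultimately have "y - ?s = 0" by (rule assms(3))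
    then show ?thesis by simp
  qed
  define B where "B = (\<lambda>a. rat_point (v a)) ` A"
  have inj: "inj_on (\<lambda>a. rat_point (v a)) A"
    using assms(5,6) by (intro inj_onI) (metis less_irrefl)
  show "vec.dim V = card A"
  proof (rule vec.dim_unique)
    show "B \<subseteq> V" using assms(4) by (auto simp: B_def)
    show "V \<subseteq> vec.span B"
    proof
      fix y assume "y \<in> V"
      show "y \<in> vec.span B" unfolding B_def
        by (subst repr[OF \<open>y \<in> V\<close>]) (intro vec.span_sum vec.span_scale vec.span_base imageI)
    qed
    show "vec.independent B"
    proof (rule vec.independent_if_scalars_zero)
      fix c x assume c: "(\<Sum>x\<in>B. c x *s x) = 0" and "x \<in> B"
      then obtain b where b: "b \<in> A" "x = rat_point (v b)" by (auto simp: B_def)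
      have "(\<Sum>a\<in>A. c (rat_point (v a)) *s rat_point (v a)) = 0"
        using c unfolding B_def sum.reindex[OF inj] by simp
      then show "c x = 0" using pair[OF b(1), of "\<lambda>a. c (rat_point (v a))"] assms(5)[OF b(1)] b(2) by simp
    qed (use assms(1) in \<open>simp add: B_def\<close>)
    show "card B = card A" unfolding B_def by (rule card_image[OF inj])
  qed
  define m where "m i = (\<Sum>a\<in>A. int (M a) * \<bar>v a $ i\<bar>)" for i
  have "finite {n :: int ^ 'k. \<forall>i. n $ i \<in> {- m i..m i}}" by (rule finite_vec_box) simp
  moreover have "n $ i \<in> {- m i..m i}" if n: "rat_point n \<in> V" "\<forall>a\<in>A. 0 \<le> pairing (rat_point n) a \<and>
      pairing (rat_point n) a \<le> of_nat (M a) * pairing (rat_point (v a)) a" for n i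
  proof -
    define r where "r a = pairing (rat_point n) a / pairing (rat_point (v a)) a" for a
    have r: "\<bar>r a\<bar> \<le> of_nat (M a)" if "a \<in> A" for a
    proof -
      have "0 \<le> r a" "r a \<le> of_nat (M a)"
        using n(2) assms(5)[OF that] that by (simp_all add: r_def pos_divide_le_eq)
      then show ?thesis by simp
    qed
    have "of_int (n $ i) = rat_point n $ i" by (simp add: rat_point_def)
    also have "\<dots> = (\<Sum>a\<in>A. r a *s rat_point (v a)) $ i" using repr[OF n(1)] by (simp add: r_def)
    also have "\<dots> = (\<Sum>a\<in>A. r a * of_int (v a $ i))" by (simp add: rat_point_def)
    finally have "of_int \<bar>n $ i\<bar> = \<bar>\<Sum>a\<in>A. r a * of_int (v a $ i)\<bar>" by simp
    also have "\<dots> \<le> (\<Sum>a\<in>A. \<bar>r a * of_int (v a $ i)\<bar>)" by (rule sum_abs)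
    also have "\<dots> \<le> (\<Sum>a\<in>A. of_nat (M a) * \<bar>of_int (v a $ i)\<bar>)"
      unfolding abs_mult by (intro sum_mono mult_right_mono r) auto
    also have "\<dots> = of_int (m i)" by (simp add: m_def)
    finally have "\<bar>n $ i\<bar> \<le> m i" by (simp only: of_int_le_iff)
    then show ?thesis by auto
  qed
  ultimately show "finite {n. rat_point n \<in> V \<and> (\<forall>a\<in>A. 0 \<le> pairing (rat_point n) a \<and>
      pairing (rat_point n) a \<le> of_nat (M a) * pairing (rat_point (v a)) a)}"
    by (elim finite_subset[rotated]) blast
qed

text \<open>The factors \<open>(1 - x^(v b))^(M b)\<close> confine the support to a parallelepiped:
  membership in the cone gives the lower bounds \<open>T\<close>, and each factor gives one upper
  bound \<open>S b\<close>.\<close>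

lemma closed_series_simplicial_rational:
  fixes V :: "(rat ^ 'k::finite) set"
  assumes "finite A" "vec.subspace V"
    and "\<And>y. y \<in> V \<Longrightarrow> (\<And>a. a \<in> A \<Longrightarrow> pairing y a = 0) \<Longrightarrow> y = 0"
    and v: "\<And>a. a \<in> A \<Longrightarrow> rat_point (v a) \<in> V"
      "\<And>a. a \<in> A \<Longrightarrow> pairing (rat_point (v a)) a > 0"
      "\<And>a b. a \<in> A \<Longrightarrow> b \<in> A \<Longrightarrow> a \<noteq> b \<Longrightarrow> pairing (rat_point (v a)) b = 0"
    and M: "\<And>a. a \<in> A \<Longrightarrow> (bdiff (v a) ^^ M a) f = (\<lambda>n. 0)"
  shows "rational_series (closed_series V f A)"
proof -
  define T where "T = {n. rat_point n \<in> V \<and> (\<forall>a\<in>A. pairing (rat_point n) a \<ge> 0)}"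
  define S where "S b = {n. pairing (rat_point n) b \<le> of_nat (M b) * pairing (rat_point (v b)) b}" for b
  have "\<exists>h. h \<noteq> 0 \<and> (\<forall>n. laurent_act h (closed_series V f A) n \<noteq> 0 \<longrightarrow> n \<in> T \<and> (\<forall>b\<in>A. n \<in> S b))"
  proof (rule confine_support[OF assms(1)])
    show "n \<in> T" if "closed_series V f A n \<noteq> 0" for n
      using that by (auto simp: constrained_series_def T_def split: if_splits)
    show "n + v b \<in> T" if "b \<in> A" "n \<in> T" for b n
    proof -
      have "pairing (rat_point (v b)) a \<ge> 0" if "a \<in> A" for a
        using v(2,3) \<open>b \<in> A\<close> that by (cases "a = b") (auto simp: less_imp_le)
      then show ?thesis using that v(1) assms(2)
        by (auto simp: T_def rat_point_add pairing_add_left intro: vec.subspace_add)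
    qed
    show "v b \<noteq> 0" if "b \<in> A" for b using v(2)[OF that] by auto
    show "n + v b \<in> S c" if "b \<in> A" "c \<in> A" "b \<noteq> c" "n \<in> S c" for b c n
      using that v(3)[OF that(1-3)] by (simp add: S_def rat_point_add pairing_add_left)
    show "n \<in> S b" if b: "b \<in> A" and n: "(bdiff (v b) ^^ M b) (closed_series V f A) n \<noteq> 0" for b n
    proof (rule ccontr)
      assume "n \<notin> S b"
      then have large: "pairing (rat_point n) b > of_nat (M b) * pairing (rat_point (v b)) b"
        by (simp add: S_def)
      \<comment> \<open>Beyond \<open>M b\<close> steps from the wall of \<open>b\<close>, none of
        the sampled points crosses that wall, and moving along \<open>v b\<close> does not affect
        the other constraints. Near \<open>n\<close> the series is thus a constant multiple of
        \<open>f\<close>.\<close>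
      have same: "pairing (rat_point (n - int j *s v b)) a \<ge> 0 \<longleftrightarrow> pairing (rat_point n) a \<ge> 0"
        if "a \<in> A" "j \<le> M b" for a j
      proof (cases "a = b")
        case True
        have "of_nat j * pairing (rat_point (v b)) b \<le> of_nat (M b) * pairing (rat_point (v b)) b"
          using v(2)[OF b] that(2) by (intro mult_right_mono) auto
        moreover have "0 \<le> of_nat j * pairing (rat_point (v b)) b" using v(2)[OF b] by simp
        ultimately show ?thesis using large True
          by (simp add: rat_point_diff rat_point_scale pairing_diff_left pairing_scale_left)
      next
        case False
        then show ?thesis using v(3)[OF b that(1)]
          by (simp add: rat_point_diff rat_point_scale pairing_diff_left pairing_scale_left)
      qed
      have V: "rat_point (n - int j *s v b) \<in> V \<longleftrightarrow> rat_point n \<in> V" for j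
        by (simp add: rat_point_diff rat_point_scale subspace_translate_iff[OF assms(2) v(1)[OF b]])
      have "(bdiff (v b) ^^ M b) (closed_series V f A) n =
        (bdiff (v b) ^^ M b) (\<lambda>m. of_bool (rat_point n \<in> V \<and> (\<forall>a\<in>A. pairing (rat_point n) a \<ge> 0)) * f m) n"
        by (rule bdiff_pow_cong) (simp add: constrained_series_def same V)
      then show False using n by (simp only: bdiff_pow_scale M[OF b]) simp
    qed
  qed
  then obtain h where h: "h \<noteq> 0"
      "\<And>n. laurent_act h (closed_series V f A) n \<noteq> 0 \<Longrightarrow> n \<in> T \<and> (\<forall>b\<in>A. n \<in> S b)"
    by blast
  have "finite {n. laurent_act h (closed_series V f A) n \<noteq> 0}"
    by (rule finite_subset[OF _ dual_vectors_dim_and_finite(2)[OF assms(1-3) v, of M]])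
      (use h(2) in \<open>auto simp: T_def S_def\<close>)
  then obtain g where "laurent_coeff g = laurent_act h (closed_series V f A)" by (rule ex_laurent_coeff)
  then show ?thesis unfolding rational_series_def using h(1) by (intro exI[of _ h] exI[of _ g]) simp
qed

text \<open>If \<open>a\<close> vanished on the common kernel of the other functionals in
  \<open>V\<close>, then \<open>functional_in_span\<close> would make it a combination of
  them.\<close>

lemma independent_dual_vectors:
  fixes V :: "(rat ^ 'k::finite) set"
  assumes "finite A" "vec.subspace V" "N \<ge> 1" "locally_nilpotent N f"
    and indep: "\<And>a l. a \<in> A \<Longrightarrow> \<exists>y\<in>V. pairing y a \<noteq> (\<Sum>b\<in>A - {a}. l b * pairing y b)"
  shows "\<exists>v M. \<forall>a\<in>A. rat_point (v a) \<in> V \<and> pairing (rat_point (v a)) a > 0 \<and>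
    (\<forall>b\<in>A. a \<noteq> b \<longrightarrow> pairing (rat_point (v a)) b = 0) \<and> (bdiff (v a) ^^ M a) f = (\<lambda>n. 0)"
proof -
  define Q where "Q a u M \<longleftrightarrow> rat_point u \<in> V \<and> pairing (rat_point u) a > 0 \<and>
      (\<forall>b\<in>A. a \<noteq> b \<longrightarrow> pairing (rat_point u) b = 0) \<and> (bdiff u ^^ M) f = (\<lambda>n. 0)" for a u M
  have "\<exists>u M. Q a u M" if a: "a \<in> A" for a
  proof -
    have "\<exists>y\<in>V. (\<forall>b\<in>A - {a}. pairing y b = 0) \<and> pairing y a \<noteq> 0"
    proof (rule ccontr)
      assume none: "\<not> ?thesis"
      have "\<exists>l. \<forall>y\<in>V. pairing y a = (\<Sum>b\<in>A - {a}. l b * pairing y b)"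
        by (rule functional_in_span) (use assms(1,2) none in auto)
      then show False using indep[OF a] by blast
    qed
    then obtain y where y: "y \<in> V" "\<And>b. b \<in> A - {a} \<Longrightarrow> pairing y b = 0" "pairing y a \<noteq> 0" by blast
    \<comment> \<open>Scaling by \<open>pairing y a\<close> makes the pairing with \<open>a\<close>
      a nonzero square, hence positive.\<close>
    have "pairing y a *s y \<in> V" using y(1) assms(2) by (simp add: vec.subspace_scale)
    then obtain u M c where u: "c > 0" "rat_point u = c *s (pairing y a *s y)" "rat_point u \<in> V"
        "(bdiff u ^^ M) f = (\<lambda>n. 0)"
      by (rule bdiff_direction[OF assms(2-4)])
    have "pairing (rat_point u) b = c * (pairing y a * pairing y b)" for b
      by (simp only: u(2) pairing_scale_left)
    then show ?thesis using u y unfolding Q_def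
      by (intro exI[of _ u] exI[of _ M]) (auto intro!: mult_pos_pos simp: zero_less_mult_iff)
  qed
  then have "\<exists>v M. \<forall>a\<in>A. Q a (v a) (M a)" by metis
  then show ?thesis unfolding Q_def .
qed

section \<open>Reciprocity inside a subspace\<close>

text \<open>Strong induction over proper subsets of \<open>A\<close>. The point \<open>w\<close>
  excludes relations with one-signed coefficients and serves every subset as well; the sign
  \<open>(- 1) ^ vec.dim V\<close> is fixed by \<open>V\<close> and so passes through linear
  combinations.\<close>

theorem constrained_series_reciprocity:
  fixes V :: "(rat ^ 'k::finite) set"
  assumes "finite A" "vec.subspace V" "N \<ge> 1" "locally_nilpotent N f"
    and "w \<in> V" "\<And>a. a \<in> A \<Longrightarrow> pairing w a > 0"
  shows "rational_series (closed_series V f A) \<and>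
    torsion_series (\<lambda>n. closed_series V f A n - (- 1) ^ vec.dim V * open_series V f A n)"
  using assms(1,6)
proof (induction A rule: finite_psubset_induct)
  case (psubset A)
  show ?case
  proof (cases "\<exists>a\<in>A. \<exists>l. \<forall>y\<in>V. pairing y a = (\<Sum>b\<in>A - {a}. l b * pairing y b)")
    case True
    then obtain a l where a: "a \<in> A" and l: "\<And>y. y \<in> V \<Longrightarrow> pairing y a = (\<Sum>b\<in>A - {a}. l b * pairing y b)"
      by blast
    have "\<exists>\<S> c. (\<forall>S\<in>\<S>. S \<subset> A) \<and>
        (\<forall>n. closed_series V f A n = (\<Sum>S\<in>\<S>. c S * closed_series V f S n)) \<and>
        (\<forall>n. open_series V f A n = (\<Sum>S\<in>\<S>. c S * open_series V f S n))"
      by (rule constrained_series_dependent[OF psubset.hyps(1) a assms(5) psubset.prems l])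
    then obtain \<S> c where "\<forall>S\<in>\<S>. S \<subset> A"
      and "\<forall>n. closed_series V f A n = (\<Sum>S\<in>\<S>. c S * closed_series V f S n)"
        "\<forall>n. open_series V f A n = (\<Sum>S\<in>\<S>. c S * open_series V f S n)"
      by (elim exE conjE)
    then have \<S>: "\<And>S. S \<in> \<S> \<Longrightarrow> S \<subset> A"
      and eq: "closed_series V f A = (\<lambda>n. \<Sum>S\<in>\<S>. c S * closed_series V f S n)"
        "open_series V f A = (\<lambda>n. \<Sum>S\<in>\<S>. c S * open_series V f S n)"
      by (simp_all add: fun_eq_iff)
    have IH: "rational_series (closed_series V f S)"
      "torsion_series (\<lambda>n. closed_series V f S n - (- 1) ^ vec.dim V * open_series V f S n)"
      if "S \<in> \<S>" for S
    proof -
      have "pairing w b > 0" if "b \<in> S" for b using psubset.prems \<S>[OF \<open>S \<in> \<S>\<close>] that by blast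
      from psubset.IH[OF \<S>[OF that] this] show "rational_series (closed_series V f S)"
        "torsion_series (\<lambda>n. closed_series V f S n - (- 1) ^ vec.dim V * open_series V f S n)"
        by blast+
    qed
    have "torsion_series (\<lambda>n. \<Sum>S\<in>\<S>. c S *
        (closed_series V f S n - (- 1) ^ vec.dim V * open_series V f S n))"
      by (rule torsion_series_sum[OF IH(2)])
    moreover have "rational_series (\<lambda>n. \<Sum>S\<in>\<S>. c S * closed_series V f S n)"
      by (rule rational_series_sum[OF IH(1)])
    ultimately show ?thesis
      by (simp add: eq sum_distrib_left sum_subtractf
          right_diff_distrib mult.left_commute)
  next
    case False
    then have indep: "\<exists>y\<in>V. pairing y a \<noteq> (\<Sum>b\<in>A - {a}. l b * pairing y b)" if "a \<in> A" for a l
      using that by blast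
    obtain v M where v: "\<And>a. a \<in> A \<Longrightarrow> rat_point (v a) \<in> V"
        "\<And>a. a \<in> A \<Longrightarrow> pairing (rat_point (v a)) a > 0"
        "\<And>a b. a \<in> A \<Longrightarrow> b \<in> A \<Longrightarrow> a \<noteq> b \<Longrightarrow> pairing (rat_point (v a)) b = 0"
        "\<And>a. a \<in> A \<Longrightarrow> (bdiff (v a) ^^ M a) f = (\<lambda>n. 0)"
      using independent_dual_vectors[OF psubset.hyps(1) assms(2-4) indep] by blast
    show ?thesis
    proof (cases "\<exists>y\<in>V. y \<noteq> 0 \<and> (\<forall>a\<in>A. pairing y a = 0)")
      case True
      then obtain y where "y \<in> V" "y \<noteq> 0" "\<And>a. a \<in> A \<Longrightarrow> pairing y a = 0" by blast
      \<comment> \<open>The cone contains a line direction, so both series are torsion and no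
        relation between them has to be checked.\<close>
      then have tors: "torsion_series (constrained_series V f q A)" for q
        by (rule torsion_constrained_series[OF assms(2-4)])
      show ?thesis
        using torsion_series_add[OF tors torsion_series_scale[OF tors, of "- ((- 1) ^ vec.dim V)"]]
        by (simp add: torsion_imp_rational tors)
    next
      case False
      then have zero: "\<And>y. y \<in> V \<Longrightarrow> (\<And>a. a \<in> A \<Longrightarrow> pairing y a = 0) \<Longrightarrow> y = 0" by blast
      have dim: "vec.dim V = card A"
        by (rule dual_vectors_dim_and_finite(1)[OF psubset.hyps(1) assms(2) zero v(1-3)])
      \<comment> \<open>For an \<open>a\<close> missing from \<open>T\<close>, the vector
        \<open>v a\<close> pairs to zero with all of \<open>T\<close>.\<close>
      have tors: "torsion_series (closed_series V f T)" if "T \<in> Pow A - {A}" for T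
      proof -
        obtain a where a: "a \<in> A" "a \<notin> T" using \<open>T \<in> Pow A - {A}\<close> by blast
        have "rat_point (v a) \<noteq> 0" using v(2)[OF a(1)] by auto
        then show ?thesis
          using v(1,3) a that by (intro torsion_constrained_series[OF assms(2-4), of "rat_point (v a)"]) auto
      qed
      \<comment> \<open>Because \<open>vec.dim V = card A\<close>, the term \<open>T = A\<close> in
        the expansion of the open series cancels the closed series exactly.\<close>
      have eq: "closed_series V f A n - (- 1) ^ vec.dim V * open_series V f A n =
        (\<Sum>T\<in>Pow A - {A}. - ((- 1) ^ (card A + card T)) * closed_series V f T n)" for n
      proof -
        have "open_series V f A n = (- 1) ^ card A * closed_series V f A n +
            (\<Sum>T\<in>Pow A - {A}. (- 1) ^ card T * closed_series V f T n)"
          unfolding constrained_series_none[OF psubset.hyps(1)]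
          using psubset.hyps(1) by (subst sum.remove[of _ A]) simp_all
        then show ?thesis unfolding dim
          by (simp add: distrib_left sum_distrib_left sum_negf power_add mult.assoc
              flip: power_mult_distrib)
      qed
      show ?thesis unfolding eq
        by (intro conjI torsion_series_sum[OF tors]
            closed_series_simplicial_rational[OF psubset.hyps(1) assms(2) zero v])
    qed
  qed
qed

section \<open>Faces\<close>

text \<open>Admitting \<open>c = 0\<close> accounts for the improper face \<open>C\<close>, so all
  faces are treated uniformly.\<close>

lemma cone_face_iff:
  "cone_face C G \<longleftrightarrow> (\<exists>c. (\<forall>y\<in>C. pairing y c \<ge> 0) \<and> G = {y\<in>C. pairing y c = 0})"
proof
  assume "cone_face C G"
  then consider "G = C" | c where "\<forall>y\<in>C. pairing y c \<ge> 0" "G = C \<inter> {y. pairing y c = 0}"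
    unfolding cone_face_def supporting_hyperplane_def by blast
  then show "\<exists>c. (\<forall>y\<in>C. pairing y c \<ge> 0) \<and> G = {y\<in>C. pairing y c = 0}"
  proof cases
    case 1
    then show ?thesis by (intro exI[of _ 0]) (simp add: pairing_def)
  next
    case (2 c)
    then show ?thesis by (intro exI[of _ c]) auto
  qed
next
  assume "\<exists>c. (\<forall>y\<in>C. pairing y c \<ge> 0) \<and> G = {y\<in>C. pairing y c = 0}"
  then obtain c where c: "\<forall>y\<in>C. pairing y c \<ge> 0" "G = {y\<in>C. pairing y c = 0}" by blast
  show "cone_face C G"
  proof (cases "c = 0")
    case True
    then show ?thesis using c by (simp add: cone_face_def pairing_def)
  next
    case False
    moreover have "G = C \<inter> {y. pairing y c = 0}" using c by auto
    ultimately show ?thesis using c(1) unfolding cone_face_def supporting_hyperplane_def by blast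
  qed
qed

text \<open>With \<open>s\<close> at least every ratio \<open>pairing y a / pairing w a\<close>, the
  step \<open>1 / (1 + s)\<close> is small enough; the summand 1 keeps it defined when
  \<open>s\<close> vanishes.\<close>

lemma perturbation_exists:
  assumes "finite B" "\<And>a. a \<in> B \<Longrightarrow> pairing w a > 0"
  shows "\<exists>t>0. \<forall>a\<in>B. pairing (w - t *s y) a \<ge> 0"
proof -
  define s where "s = (\<Sum>a\<in>B. \<bar>pairing y a / pairing w a\<bar>)"
  have "s \<ge> 0" by (simp add: s_def sum_nonneg)
  have "pairing (w - (1 / (1 + s)) *s y) a \<ge> 0" if "a \<in> B" for a
  proof -
    have "pairing y a / pairing w a \<le> \<bar>pairing y a / pairing w a\<bar>" by (rule abs_ge_self)
    also have "\<dots> \<le> s" unfolding s_def by (rule member_le_sum) (use assms(1) that in auto)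
    finally have "pairing y a \<le> s * pairing w a" using assms(2)[OF that] by (simp add: divide_simps)
    also have "\<dots> \<le> (1 + s) * pairing w a" using assms(2)[OF that] by (simp add: algebra_simps)
    finally show ?thesis using \<open>s \<ge> 0\<close>
      by (simp add: pairing_diff_left pairing_scale_left divide_simps mult.commute)
  qed
  then show ?thesis using \<open>s \<ge> 0\<close> by (intro exI[of _ "1 / (1 + s)"]) auto
qed

locale cone_presentation =
  fixes A C :: "(rat ^ 'k::finite) set"
  assumes finite_A: "finite A" and zero_notin_A: "0 \<notin> A"
    and C_eq: "C = {y. \<forall>a\<in>A. pairing y a \<ge> 0}"
begin

definition tight :: "(rat ^ 'k) set \<Rightarrow> (rat ^ 'k) set" where
  "tight G = {a\<in>A. \<forall>y\<in>G. pairing y a = 0}"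

lemma tight_subset: "tight G \<subseteq> A"
  by (auto simp: tight_def)

text \<open>Each constraint that is not tight is positive at some point of \<open>G\<close>; the sum
  of these points lies in \<open>G\<close> and is positive on all of them.\<close>

lemma face_interior_point:
  assumes "cone_face C G"
  obtains w where "w \<in> G" "\<And>a. a \<in> A - tight G \<Longrightarrow> pairing w a > 0"
proof -
  obtain c where c: "\<forall>y\<in>C. pairing y c \<ge> 0" "G = {y\<in>C. pairing y c = 0}"
    using assms cone_face_iff by blast
  have nonneg: "pairing y a \<ge> 0" if "y \<in> G" "a \<in> A" for y a
    using that c(2) by (auto simp: C_eq)
  have "\<exists>y\<in>G. pairing y a > 0" if a: "a \<in> A - tight G" for a
  proof -
    obtain y where "y \<in> G" "pairing y a \<noteq> 0" using a by (auto simp: tight_def)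
    then show ?thesis using nonneg[of y a] a by force
  qed
  then obtain y where y: "\<And>a. a \<in> A - tight G \<Longrightarrow> y a \<in> G \<and> pairing (y a) a > 0" by metis
  define w where "w = (\<Sum>a\<in>A - tight G. y a)"
  have "w \<in> G" unfolding w_def c(2) C_eq
    using y by (auto simp: pairing_sum_left c(2) C_eq intro!: sum_nonneg sum.neutral)
  moreover have "pairing w a > 0" if "a \<in> A - tight G" for a
  proof -
    have "0 < pairing (y a) a" using y that by blast
    also have "\<dots> \<le> pairing w a" unfolding w_def pairing_sum_left
      by (rule member_le_sum) (use that y nonneg finite_A in auto)
    finally show ?thesis .
  qed
  ultimately show ?thesis using that by blast
qed

text \<open>If \<open>y\<close> in \<open>C\<close> satisfies the tight equations, then
  \<open>w - t y\<close> stays in \<open>C\<close> for small \<open>t > 0\<close>. Since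
  \<open>c\<close> vanishes at \<open>w\<close> and is nonnegative on \<open>C\<close>, this forces
  \<open>pairing y c \<le> 0\<close>.\<close>

lemma face_eq_tight:
  assumes "cone_face C G"
  shows "G = {y\<in>C. \<forall>a\<in>tight G. pairing y a = 0}"
proof -
  obtain c where c: "\<forall>y\<in>C. pairing y c \<ge> 0" "G = {y\<in>C. pairing y c = 0}"
    using assms cone_face_iff by blast
  obtain w where w: "w \<in> G" "\<And>a. a \<in> A - tight G \<Longrightarrow> pairing w a > 0"
    using face_interior_point[OF assms] by blast
  have "y \<in> G" if y: "y \<in> C" "\<And>a. a \<in> tight G \<Longrightarrow> pairing y a = 0" for y
  proof -
    obtain t where t: "t > 0" "\<And>a. a \<in> A - tight G \<Longrightarrow> pairing (w - t *s y) a \<ge> 0"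
      using perturbation_exists[of "A - tight G" w y] w(2) finite_A by blast
    have "pairing (w - t *s y) a = 0" if "a \<in> tight G" for a
      using that w(1) y(2) by (simp add: tight_def pairing_diff_left pairing_scale_left)
    then have "w - t *s y \<in> C" using t(2) unfolding C_eq by force
    then have "pairing (w - t *s y) c \<ge> 0" using c(1) by blast
    then have "t * pairing y c \<le> 0" using w(1) c(2) by (simp add: pairing_diff_left pairing_scale_left)
    then have "pairing y c \<le> 0" using t(1) by (simp add: mult_le_0_iff)
    then show ?thesis using c y(1) by force
  qed
  moreover have "G \<subseteq> C" using c by auto
  ultimately show ?thesis by (auto simp: tight_def)
qed

lemma face_eq_constraints:
  assumes "cone_face C G"
  shows "G = {y. (\<forall>a\<in>tight G. pairing y a = 0) \<and> (\<forall>a\<in>A - tight G. pairing y a \<ge> 0)}"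
proof -
  have "y \<in> C \<and> (\<forall>a\<in>tight G. pairing y a = 0) \<longleftrightarrow>
    (\<forall>a\<in>tight G. pairing y a = 0) \<and> (\<forall>a\<in>A - tight G. pairing y a \<ge> 0)" for y
    using tight_subset[of G] unfolding C_eq by force
  then show ?thesis using face_eq_tight[OF assms] by auto
qed

text \<open>The sum of the functionals in \<open>E\<close> is nonnegative on \<open>C\<close> and
  vanishes only where every summand does, so it exposes the face.\<close>

lemma cone_face_constraints:
  assumes "E \<subseteq> A"
  shows "cone_face C {y\<in>C. \<forall>a\<in>E. pairing y a = 0}"
proof -
  have fin: "finite E" using assms finite_A finite_subset by blast
  have sum: "pairing y (\<Sum>E) = (\<Sum>a\<in>E. pairing y a)" for y
    using pairing_sum_left[of "\<lambda>a. a" E y] by (simp add: pairing_commute)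
  have nonneg: "pairing y a \<ge> 0" if "y \<in> C" "a \<in> E" for y a using that assms by (auto simp: C_eq)
  show ?thesis unfolding cone_face_iff
  proof (intro exI[of _ "\<Sum>E"] conjI ballI)
    show "pairing y (\<Sum>E) \<ge> 0" if "y \<in> C" for y unfolding sum by (intro sum_nonneg nonneg that)
    have "(\<forall>a\<in>E. pairing y a = 0) \<longleftrightarrow> pairing y (\<Sum>E) = 0" if "y \<in> C" for y
      unfolding sum by (rule sum_nonneg_eq_0_iff[symmetric]) (use fin nonneg that in auto)
    then show "{y\<in>C. \<forall>a\<in>E. pairing y a = 0} = {y\<in>C. pairing y (\<Sum>E) = 0}" by auto
  qed
qed

lemma cone_interior_face:
  assumes "cone_face C G"
  shows "cone_interior G = {y. (\<forall>a\<in>tight G. pairing y a = 0) \<and> (\<forall>a\<in>A - tight G. pairing y a > 0)}"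
proof (intro set_eqI iffI)
  obtain w where w: "w \<in> G" "\<And>a. a \<in> A - tight G \<Longrightarrow> pairing w a > 0"
    using face_interior_point[OF assms] by blast
  fix y
  {
    assume y: "y \<in> cone_interior G"
    then have "y \<in> G" by (simp add: cone_interior_def)
    then have y': "\<forall>a\<in>tight G. pairing y a = 0" "\<forall>a\<in>A - tight G. pairing y a \<ge> 0"
      using face_eq_constraints[OF assms] by auto
    have "pairing y a \<noteq> 0" if a: "a \<in> A - tight G" for a
    proof
      assume 0: "pairing y a = 0"
      \<comment> \<open>A face of \<open>G\<close> containing \<open>y\<close>; it is proper because
        \<open>a\<close> is positive at \<open>w\<close>.\<close>
      define F where "F = {z\<in>G. pairing z a = 0}"
      have "cone_face G F" unfolding cone_face_iff F_def
        using a face_eq_constraints[OF assms] by (intro exI[of _ a]) auto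
      moreover have "F \<noteq> G" using w a unfolding F_def by force
      moreover have "y \<in> F" using \<open>y \<in> G\<close> 0 by (simp add: F_def)
      ultimately show False using y unfolding cone_interior_def by blast
    qed
    then show "y \<in> {y. (\<forall>a\<in>tight G. pairing y a = 0) \<and> (\<forall>a\<in>A - tight G. pairing y a > 0)}"
      using y' by force
  }
  {
    assume y: "y \<in> {y. (\<forall>a\<in>tight G. pairing y a = 0) \<and> (\<forall>a\<in>A - tight G. pairing y a > 0)}"
    then have "y \<in> G" by (subst face_eq_constraints[OF assms]) (auto simp: less_imp_le)
    \<comment> \<open>Moving from \<open>y\<close> slightly away from any \<open>z\<close> in
      \<open>G\<close> stays in \<open>G\<close>, so a functional exposing a face through
      \<open>y\<close> must vanish at \<open>z\<close> too.\<close>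
    have "F = G" if "cone_face G F" "y \<in> F" for F
    proof -
      obtain c where c: "\<forall>y\<in>G. pairing y c \<ge> 0" "F = {y\<in>G. pairing y c = 0}"
        using \<open>cone_face G F\<close> cone_face_iff by blast
      have "pairing z c = 0" if z: "z \<in> G" for z
      proof -
        obtain t where t: "t > 0" "\<And>a. a \<in> A - tight G \<Longrightarrow> pairing (y - t *s z) a \<ge> 0"
          using perturbation_exists[of "A - tight G" y z] y finite_A by blast
        have "pairing (y - t *s z) a = 0" if "a \<in> tight G" for a
          using that y z by (simp add: tight_def pairing_diff_left pairing_scale_left)
        then have "y - t *s z \<in> G" using t(2) by (subst face_eq_constraints[OF assms]) auto
        then have "pairing (y - t *s z) c \<ge> 0" using c(1) by blast
        then have "t * pairing z c \<le> 0"
          using \<open>y \<in> F\<close> c(2) by (simp add: pairing_diff_left pairing_scale_left)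
        then have "pairing z c \<le> 0" using t(1) by (simp add: mult_le_0_iff)
        then show ?thesis using c(1) z by force
      qed
      then show ?thesis using c(2) by auto
    qed
    then show "y \<in> cone_interior G" using \<open>y \<in> G\<close> unfolding cone_interior_def by blast
  }
qed

text \<open>Every solution \<open>y\<close> of the tight equations is a multiple of the difference
  of two points of \<open>G\<close>, namely \<open>w\<close> and \<open>w - t y\<close>.\<close>

lemma span_face:
  assumes "cone_face C G"
  shows "vec.span G = {y. \<forall>a\<in>tight G. pairing y a = 0}" (is "_ = ?V")
proof
  have V: "vec.subspace ?V"
    by (auto simp: vec.subspace_def pairing_add_left pairing_scale_left)
  show "vec.span G \<subseteq> ?V"
    by (rule vec.span_minimal[OF _ V]) (auto simp: tight_def)
  show "?V \<subseteq> vec.span G"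
  proof
    fix y assume y: "y \<in> ?V"
    obtain w where w: "w \<in> G" "\<And>a. a \<in> A - tight G \<Longrightarrow> pairing w a > 0"
      using face_interior_point[OF assms] by blast
    obtain t where t: "t > 0" "\<And>a. a \<in> A - tight G \<Longrightarrow> pairing (w - t *s y) a \<ge> 0"
      using perturbation_exists[of "A - tight G" w y] w(2) finite_A by blast
    have "pairing (w - t *s y) a = 0" if "a \<in> tight G" for a
      using that w(1) y by (simp add: tight_def pairing_diff_left pairing_scale_left)
    then have "w - t *s y \<in> G" using t(2) by (subst face_eq_constraints[OF assms]) auto
    then have "(1 / t) *s (w - (w - t *s y)) \<in> vec.span G"
      using w(1) by (intro vec.span_scale vec.span_diff vec.span_base)
    moreover have "(1 / t) *s (w - (w - t *s y)) = y" using t(1) by (simp add: vec_eq_iff)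
    ultimately show "y \<in> vec.span G" by simp
  qed
qed

text \<open>Negating the constraints that are not tight makes the closed conditions describe
  \<open>-G\<close> and the open ones the relative interior of \<open>G\<close>, both inside the
  span of \<open>G\<close>. The positive point becomes \<open>- w\<close>.\<close>

lemma face_reciprocity:
  assumes "cone_face C G" "N \<ge> 1" "locally_nilpotent N f"
  shows "rational_series (\<lambda>n. if rat_point (- n) \<in> G then f n else 0)"
    and "torsion_series (\<lambda>n. (if rat_point (- n) \<in> G then f n else 0) -
      (- 1) ^ vec.dim G * (if rat_point n \<in> cone_interior G then f n else 0))"
proof -
  define V where "V = vec.span G"
  have V: "V = {y. \<forall>a\<in>tight G. pairing y a = 0}" unfolding V_def by (rule span_face[OF assms(1)])
  have subspace: "vec.subspace V" unfolding V_def by (rule vec.subspace_span)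
  define B where "B = uminus ` (A - tight G)"
  obtain w where w: "w \<in> G" "\<And>a. a \<in> A - tight G \<Longrightarrow> pairing w a > 0"
    using face_interior_point[OF assms(1)] by blast
  have neg: "pairing (- y) a = - pairing y a" for y a :: "rat ^ 'k"
    by (simp add: pairing_def sum_negf)
  have "- w \<in> V" unfolding V_def by (rule vec.span_neg[OF vec.span_base[OF w(1)]])
  moreover have "pairing (- w) b > 0" if "b \<in> B" for b using that w(2) by (auto simp: B_def neg)
  moreover have "finite B" using finite_A by (simp add: B_def)
  ultimately have "rational_series (closed_series V f B) \<and>
    torsion_series (\<lambda>n. closed_series V f B n - (- 1) ^ vec.dim V * open_series V f B n)"
    using constrained_series_reciprocity[OF _ subspace assms(2,3), of B "- w"] by simp
  moreover have "closed_series V f B = (\<lambda>n. if rat_point (- n) \<in> G then f n else 0)"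
    by (subst face_eq_constraints[OF assms(1)])
      (simp add: constrained_series_def fun_eq_iff V B_def rat_point_minus neg)
  moreover have "open_series V f B = (\<lambda>n. if rat_point n \<in> cone_interior G then f n else 0)"
    by (simp add: constrained_series_def fun_eq_iff V B_def cone_interior_face[OF assms(1)])
  ultimately show "rational_series (\<lambda>n. if rat_point (- n) \<in> G then f n else 0)"
    "torsion_series (\<lambda>n. (if rat_point (- n) \<in> G then f n else 0) -
      (- 1) ^ vec.dim G * (if rat_point n \<in> cone_interior G then f n else 0))"
    by (simp_all add: V_def)
qed

lemma tight_of_interior_point:
  assumes "cone_face C G" "y \<in> cone_interior G"
  shows "tight G = {a\<in>A. pairing y a = 0}"
proof -
  have zero: "\<forall>a\<in>tight G. pairing y a = 0" and pos: "\<forall>a\<in>A - tight G. pairing y a > 0"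
    using assms(2) unfolding cone_interior_face[OF assms(1)] by simp_all
  have "pairing y a \<noteq> 0" if "a \<in> A - tight G" for a using pos that by force
  then show ?thesis using zero tight_subset[of G] by blast
qed

lemma interior_subset_cone: "cone_face C G \<Longrightarrow> cone_interior G \<subseteq> C"
  using face_eq_tight[of G] by (auto simp: cone_interior_def)

text \<open>The face is cut out by the constraints vanishing at \<open>y\<close>. The equivalence of
  \<open>F \<subseteq> G\<close> and \<open>y \<in> G\<close> will turn the sum over larger faces in
  the dual weight into a sum over faces containing the point.\<close>

lemma smallest_face:
  assumes "y \<in> C"
  shows "\<exists>F. cone_face C F \<and> y \<in> cone_interior F \<and>
    (\<forall>G. cone_face C G \<longrightarrow> (y \<in> cone_interior G \<longrightarrow> G = F) \<and> (F \<subseteq> G \<longleftrightarrow> y \<in> G))"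
proof -
  define E where "E = {a\<in>A. pairing y a = 0}"
  define F where "F = {z\<in>C. \<forall>a\<in>E. pairing z a = 0}"
  have F: "cone_face C F" unfolding F_def by (rule cone_face_constraints) (auto simp: E_def)
  have "y \<in> F" using assms by (simp add: F_def E_def)
  then have "tight F = E" by (auto simp: tight_def F_def E_def)
  have pos: "\<forall>a\<in>A - E. pairing y a > 0" using assms by (auto simp: C_eq E_def order_less_le)
  then have int: "y \<in> cone_interior F"
    unfolding cone_interior_face[OF F] \<open>tight F = E\<close> by (auto simp: E_def)
  show ?thesis
  proof (intro exI[of _ F] conjI allI impI F int)
    fix G assume G: "cone_face C G"
    show "G = F" if "y \<in> cone_interior G"
    proof -
      have "tight G = E" using tight_of_interior_point[OF G that] by (simp add: E_def)
      then show ?thesis using face_eq_tight[OF G] by (simp add: F_def)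
    qed
    show "F \<subseteq> G \<longleftrightarrow> y \<in> G"
    proof
      assume "y \<in> G"
      then have "tight G \<subseteq> E" by (auto simp: tight_def E_def)
      then show "F \<subseteq> G" by (subst face_eq_tight[OF G]) (auto simp: F_def)
    qed (use \<open>y \<in> F\<close> in blast)
  qed
qed

section \<open>Decomposition of the series over faces\<close>

lemma finite_faces: "finite {G. cone_face C G}"
proof (rule finite_subset)
  show "{G. cone_face C G} \<subseteq> (\<lambda>E. {y\<in>C. \<forall>a\<in>E. pairing y a = 0}) ` Pow A"
    using face_eq_tight tight_subset by blast
qed (simp add: finite_A)

lemma weight_at_eq:
  assumes "cone_face C F" "y \<in> cone_interior F"
    and "\<And>G. cone_face C G \<Longrightarrow> y \<in> cone_interior G \<Longrightarrow> G = F"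
  shows "weight_at C \<omega> y = \<omega> F"
proof -
  have "(THE F. cone_face C F \<and> y \<in> cone_interior F) = F"
    by (rule the_equality) (use assms in blast)+
  then show ?thesis by (simp add: weight_at_def)
qed

text \<open>The relative interiors of the faces partition the cone, so at most one summand
  survives.\<close>

lemma cone_series_eq:
  "cone_series C \<omega> f n =
    (\<Sum>G | cone_face C G. \<omega> G * (if rat_point n \<in> cone_interior G then f n else 0))"
proof (cases "rat_point n \<in> C")
  case True
  obtain F where F: "cone_face C F" "rat_point n \<in> cone_interior F"
    and others: "\<forall>G. cone_face C G \<longrightarrow>
      (rat_point n \<in> cone_interior G \<longrightarrow> G = F) \<and> (F \<subseteq> G \<longleftrightarrow> rat_point n \<in> G)"
    using smallest_face[OF True] by (elim exE conjE)
  have "weight_at C \<omega> (rat_point n) = \<omega> F"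
    by (rule weight_at_eq[OF F]) (use others in blast)
  moreover have "(\<Sum>G | cone_face C G. \<omega> G * (if rat_point n \<in> cone_interior G then f n else 0)) =
      (\<Sum>G | cone_face C G. if G = F then \<omega> F * f n else 0)"
  proof (intro sum.cong refl)
    fix G assume "G \<in> {G. cone_face C G}"
    then have "rat_point n \<in> cone_interior G \<longleftrightarrow> G = F" using F others by blast
    then show "\<omega> G * (if rat_point n \<in> cone_interior G then f n else 0) =
        (if G = F then \<omega> F * f n else 0)" by simp
  qed
  ultimately show ?thesis using True F(1) finite_faces by (simp add: cone_series_def)
next
  case False
  then have "rat_point n \<notin> cone_interior G" if "cone_face C G" for G
    using interior_subset_cone[OF that] by blast
  then show ?thesis using False by (simp add: cone_series_def)
qed

text \<open>For a point in the interior of \<open>F\<close>, the faces above \<open>F\<close> are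
  those containing the point, so the dual weight assembles into indicators of whole closed
  faces.\<close>

lemma cone_series_dual_eq:
  "cone_series C (dual_weight C \<omega>) f n =
    (\<Sum>G | cone_face C G. \<omega> G * (- 1) ^ vec.dim G * (if rat_point n \<in> G then f n else 0))"
proof (cases "rat_point n \<in> C")
  case True
  obtain F where F: "cone_face C F" "rat_point n \<in> cone_interior F"
    and others: "\<forall>G. cone_face C G \<longrightarrow>
      (rat_point n \<in> cone_interior G \<longrightarrow> G = F) \<and> (F \<subseteq> G \<longleftrightarrow> rat_point n \<in> G)"
    using smallest_face[OF True] by (elim exE conjE)
  have weight: "weight_at C \<eta> (rat_point n) = \<eta> F" for \<eta>
    by (rule weight_at_eq[OF F]) (use others in blast)
  have above: "F \<subseteq> G \<longleftrightarrow> rat_point n \<in> G" if "cone_face C G" for G using others that by blast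
  have "dual_weight C \<omega> F * f n =
      (\<Sum>G | cone_face C G \<and> F \<subseteq> G. \<omega> G * (- 1) ^ vec.dim G * f n)"
    unfolding dual_weight_def sum_distrib_right by (simp add: mult_ac)
  also have "\<dots> = (\<Sum>G | cone_face C G. \<omega> G * (- 1) ^ vec.dim G * (if rat_point n \<in> G then f n else 0))"
    using finite_faces above by (intro sum.mono_neutral_cong_left) auto
  finally show ?thesis using True by (simp add: cone_series_def weight)
next
  case False
  then have "rat_point n \<notin> G" if "cone_face C G" for G
    using face_eq_tight[OF that] by blast
  then show ?thesis using False by (simp add: cone_series_def)
qed

end

theorem theorem2p9:
  fixes C :: "(rat ^ 'k::finite) set"
    and \<omega> :: "(rat ^ 'k) set \<Rightarrow> complex"
    and f :: "int ^ 'k \<Rightarrow> complex"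
  assumes "rational_cone C" and "quasi_polynomial f"
  shows "(\<exists>R. expansion_of (cone_series C \<omega> f) R) \<and>
         (\<exists>R. expansion_of (cone_series C (dual_weight C \<omega>) (\<lambda>n. f (- n))) R) \<and>
         ratfun_inv (ratfun_of (cone_series C \<omega> f)) =
           ratfun_of (cone_series C (dual_weight C \<omega>) (\<lambda>n. f (- n)))"
proof -
  obtain A where "cone_presentation A C"
    using assms(1) by (auto simp: rational_cone_def cone_presentation_def)
  then interpret cone_presentation A C .
  obtain N where N: "N \<ge> 1" "locally_nilpotent N f"
    using quasi_polynomial_locally_nilpotent[OF assms(2)] by blast
  define Y where "Y = cone_series C \<omega> f"
  define Z where "Z = cone_series C (dual_weight C \<omega>) (\<lambda>n. f (- n))"
  define P where "P G n = (if rat_point (- n) \<in> G then f n else 0)" for G n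
  define Q where "Q G n = (if rat_point n \<in> cone_interior G then f n else 0)" for G n
  have PQ: "rational_series (P G)" "torsion_series (\<lambda>n. P G n - (- 1) ^ vec.dim G * Q G n)"
    if "G \<in> {G. cone_face C G}" for G
    using face_reciprocity[OF _ N] that by (simp_all add: P_def[abs_def] Q_def)
  have Y: "Y n = (\<Sum>G | cone_face C G. \<omega> G * Q G n)" for n
    by (simp add: Y_def cone_series_eq Q_def)
  \<comment> \<open>At \<open>- n\<close> the reflection of \<open>f\<close> is undone, so
    \<open>P\<close> and \<open>Q\<close> carry the same \<open>f\<close>.\<close>
  have Z: "Z (- n) = (\<Sum>G | cone_face C G. (\<omega> G * (- 1) ^ vec.dim G) * P G n)" for n
    by (simp add: Z_def cone_series_dual_eq P_def cong: if_cong)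
  have ratZ: "rational_series (\<lambda>n. Z (- n))" unfolding Z by (rule rational_series_sum[OF PQ(1)])
  have "torsion_series (\<lambda>n. \<Sum>G | cone_face C G. (\<omega> G * (- 1) ^ vec.dim G) *
      (P G n - (- 1) ^ vec.dim G * Q G n))"
    by (rule torsion_series_sum[OF PQ(2)])
  \<comment> \<open>The two signs \<open>(- 1) ^ vec.dim G\<close> multiply to 1, which leaves
    exactly the weights in \<open>Y\<close>.\<close>
  moreover have "(\<Sum>G | cone_face C G. (\<omega> G * (- 1) ^ vec.dim G) *
      (P G n - (- 1) ^ vec.dim G * Q G n)) = Z (- n) - Y n" for n
    unfolding Y Z sum_subtractf[symmetric]
    by (intro sum.cong) (simp_all add: algebra_simps flip: power_mult_distrib mult.assoc)
  ultimately have tors: "torsion_series (\<lambda>n. Z (- n) - Y n)" by simp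
  \<comment> \<open>\<open>Y\<close> is recovered as the reflected \<open>Z\<close> minus a torsion
    series, so its rationality follows from that of the closed faces.\<close>
  have "rational_series (\<lambda>n. Z (- n) + (- 1) * (Z (- n) - Y n))"
    by (intro rational_series_add rational_series_scale ratZ torsion_imp_rational tors)
  then have ratY: "rational_series Y" by simp
  have "rational_series Z" using rational_series_inv[OF ratZ] by simp
  moreover have "torsion_series (\<lambda>n. Z n - Y (- n))" using torsion_series_inv[OF tors] by simp
  ultimately show ?thesis
    using ratY ratfun_inv_ratfun_of[OF ratY] by (simp add: rational_series_iff Y_def Z_def)
qed

end
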